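(* Let $\tau\in\mathbb{C}$ with $\mathrm{Im}(\tau)>0$ and $q=e^{2i\pi\tau}$ (with $q^{s}=e^{2i\pi\tau s}$). Then, as meromorphic functions of $z\in\mathbb{C}$, $$CD(z,\tau)=\cos(\pi z)\,q^{1/4}\prod_{n=0}^{+\infty}\frac{(1-q^{n+1})^2}{(1-q^{n+1/2})^2}\prod_{n=0}^{+\infty}\frac{\left(1+e^{2i\pi z}q^{n+1}\right)\left(1+e^{-2i\pi z}q^{n+1}\right)}{\left(1+e^{2i\pi z}q^{n+1/2}\right)\left(1+e^{-2i\pi z}q^{n+1/2}\right)}.$$
   Context: The function $z\mapsto CD(z,\tau)$ is the meromorphic function on $\mathbb{C}$ (the renormalized Jacobi function $\mathrm{cd}$) which for $z=x+y\tau$ ($x,y\in\mathbb{R}$) is given by $$CD(z,\tau)=\frac{i}{2}\sum_{n=0}^{+\infty}\frac{(-1)^n\cos((2n+1)\pi z)}{\sin((n+\frac12)\pi\tau)}\ \text{ when }|y|<\tfrac12,\qquad CD(z,\tau)=\frac{i}{4\tau}+\frac{i}{2\tau}\sum_{n=1}^{+\infty}\frac{(-1)^n\cos(2n\pi z/\tau)}{\cos(n\pi/\tau)}\ \text{ when }|x|<\tfrac12 .$$ *)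

theory Defs
  imports "HOL-Complex_Analysis.Complex_Analysis"
begin

text \<open>The power \<open>q^s\<close>, \<open>q = e^(2 i \<pi> \<tau>)\<close>, is a function of \<open>\<tau>\<close> and not of \<open>q\<close>: for non-integral
  \<open>s\<close> its branch is not determined by \<open>q\<close>.\<close>

definition qpow :: "complex \<Rightarrow> real \<Rightarrow> complex" where
  "qpow \<tau> s = exp (2 * \<i> * of_real pi * \<tau> * of_real s)"

text \<open>A meromorphic function on the plane is represented by its normalised version
  (\<open>nicely_meromorphic_on\<close>: continuous off the poles and 0 at the poles), so that prescribing
  it on a nonempty open set determines it as a HOL function. The sum over \<open>n \<ge> 1\<close> is
  reindexed from 0, hence \<open>Suc n\<close>.\<close>

definition is_CD :: "complex \<Rightarrow> (complex \<Rightarrow> complex) \<Rightarrow> bool" where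
  "is_CD \<tau> F \<longleftrightarrow>
     F nicely_meromorphic_on UNIV \<and>
     (\<forall>x y :: real. \<forall>z. z = of_real x + of_real y * \<tau> \<longrightarrow>
        (\<bar>y\<bar> < 1/2 \<longrightarrow>
           (\<lambda>n. \<i> / 2 * ((-1) ^ n * cos ((2 * of_nat n + 1) * of_real pi * z)
                         / sin ((of_nat n + 1/2) * of_real pi * \<tau>))) sums F z) \<and>
        (\<bar>x\<bar> < 1/2 \<longrightarrow>
           (\<lambda>n. \<i> / (2 * \<tau>) * ((-1) ^ Suc n * cos (2 * of_nat (Suc n) * of_real pi * z / \<tau>)
                               / cos (of_nat (Suc n) * of_real pi / \<tau>)))
             sums (F z - \<i> / (4 * \<tau>))))"

definition CD :: "complex \<Rightarrow> complex \<Rightarrow> complex" where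
  "CD z \<tau> = (THE F. is_CD \<tau> F) z"

end

theory Submission
  imports Defs
begin

text \<open>Expanding \<open>1 / sin\<close> and \<open>1 / cos\<close> in geometric series and exchanging the summations turns the
  two trigonometric series into Lambert series that converge on the whole plane: the first into
  \<open>1/4\<close> times the sum of \<open>1 / cos (\<pi> (z + (m + 1/2) \<tau>))\<close> over all integers \<open>m\<close>, the second into an
  alternating sum of tangents of \<open>\<pi> (z - m - 1/2) / \<tau>\<close>. Both sums and the infinite product are
  antiperiodic under \<open>z \<mapsto> z + 1\<close>, periodic under \<open>z \<mapsto> z + \<tau>\<close>, and have only simple poles, at
  \<open>(1 + \<tau>) / 2 + \<int> + \<int> \<tau>\<close>, with residue \<open>- 1 / (4 \<pi>)\<close> at \<open>(1 + \<tau>) / 2\<close>; the constant factor of the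
  product is what normalises its residue. The difference of two such functions is entire and
  bounded, so it is constant, and antiperiodicity makes the constant zero.\<close>

subsection \<open>Lambert series\<close>

text \<open>Each trigonometric series converges only in its own strip, and the two strips cross.
  \<open>CD\<close> is a definite description, so one global function has to be shown to satisfy
  both expansions; the normalised product is that witness. Uniqueness costs little, since the open
  strip of one series already determines a normalised meromorphic function. In each series one shift
  is visible from the exponentials: \<open>z + 1\<close> for the series in \<open>z\<close>,
  \<open>z + \<tau>\<close> for the one in \<open>z / \<tau>\<close>. The other shift multiplies the
  exponential by a power of the nome and so re-indexes the Lambert sums: one term passes between the
  two one-sided sums. For the tangents this exchange leaves a remainder 1, which is exactly
  compensated by the constant term \<open>\<i> / (4 * \<tau>)\<close>. The poles form a single orbit
  of the lattice, so one limit at one pole controls the principal parts everywhere.\<close>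

text \<open>The geometric bound makes the double family absolutely summable, so the ordered
  \<open>sums\<close> become unordered \<open>has_sum\<close> statements, to which Fubini applies in
  both directions. The limit is written as a sum of rows because \<open>lambert\<close> is defined
  as such a sum.\<close>

lemma sums_swap_geometric_bound:
  fixes f :: "nat \<Rightarrow> nat \<Rightarrow> complex"
  assumes bound: "\<And>m n. norm (f m n) \<le> K * a ^ m * b ^ n"
    and a: "0 \<le> a" "a < 1" and b: "0 \<le> b" "b < 1"
    and rows: "\<And>m. f m sums g m"
    and cols: "\<And>n. (\<lambda>m. f m n) sums h n"
  shows "h sums (\<Sum>m. g m)"
proof -
  have geo: "((\<lambda>n. c ^ n) has_sum (1 / (1 - c))) UNIV" if "0 \<le> c" "c < 1" for c :: real
    using that geometric_sums[of c]
    by (intro norm_summable_imp_has_sum) (auto simp: norm_power)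
  have "(\<lambda>(m, n). K * a ^ m * b ^ n) summable_on (UNIV \<times> UNIV)"
  proof -
    have "(\<lambda>x. case x of (m, n) \<Rightarrow> a ^ m * b ^ n) summable_on (UNIV \<times> UNIV)"
    proof (rule summable_on_SigmaI)
      fix m
      show "((\<lambda>n. case (m, n) of (m, n) \<Rightarrow> a ^ m * b ^ n) has_sum (a ^ m * (1 / (1 - b)))) UNIV"
        using has_sum_cmult_right[OF geo[OF b], of "a ^ m"] by simp
    next
      show "(\<lambda>m. a ^ m * (1 / (1 - b))) summable_on UNIV"
        using has_sum_cmult_left[OF geo[OF a]] by (meson has_sum_imp_summable)
    qed (use a b in auto)
    from summable_on_cmult_right[OF this, of K] show ?thesis
      by (simp add: case_prod_unfold mult.assoc)
  qed
  hence "(\<lambda>x. norm (case x of (m, n) \<Rightarrow> f m n)) summable_on (UNIV \<times> UNIV)"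
    by (rule Infinite_Sum.abs_summable_on_comparison_test') (simp only: case_prod_unfold bound)
  hence summ: "(\<lambda>(m, n). f m n) summable_on (UNIV \<times> UNIV)"
    by (rule abs_summable_summable)
  define S where "S = infsum (\<lambda>(m, n). f m n) (UNIV \<times> UNIV)"
  have S: "((\<lambda>(m, n). f m n) has_sum S) (UNIV \<times> UNIV)"
    unfolding S_def using summ by (rule has_sum_infsum)
  have S': "((\<lambda>(n, m). f m n) has_sum S) (UNIV \<times> UNIV)"
    using S by (subst has_sum_swap) (simp add: case_prod_unfold)
  have rows': "(f m has_sum g m) UNIV" for m
    using summable_on_SigmaD1[OF summ, of m] rows[of m]
    by (metis UNIV_I has_sum_imp_sums has_sum_infsum sums_unique2)
  have cols': "((\<lambda>m. f m n) has_sum h n) UNIV" for n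
    using summable_on_SigmaD1[of "\<lambda>n m. f m n" UNIV "\<lambda>_. UNIV" n] S' cols[of n]
    by (metis UNIV_I has_sum_imp_sums has_sum_infsum sums_unique2 has_sum_imp_summable)
  have "(g has_sum S) UNIV"
    by (rule has_sum_SigmaD[OF S]) (use rows' in auto)
  hence "(\<Sum>m. g m) = S"
    using has_sum_imp_sums sums_unique by metis
  moreover have "(h has_sum S) UNIV"
    by (rule has_sum_SigmaD[OF S']) (use cols' in auto)
  ultimately show ?thesis
    using has_sum_imp_sums by metis
qed

text \<open>With \<open>w = exp (\<i> t)\<close>, \<open>kernel 2 w\<close> is
  \<open>1 / (2 cos t)\<close>; with \<open>w = exp (2 \<i> t)\<close>, \<open>kernel 1 w\<close> is
  \<open>(1 + \<i> tan t) / 2\<close>. The exponent \<open>e\<close> lets one theory serve both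
  series.\<close>

definition kernel :: "nat \<Rightarrow> complex \<Rightarrow> complex" where
  "kernel e w = w / (1 + w ^ e)"

text \<open>One half of a bilateral sum; the other half is the value at \<open>inverse v\<close>.
  The odd powers of \<open>\<rho>\<close> encode the shifts by half-integers, and \<open>s\<close>
  is the sign in the denominators \<open>1 - s * \<rho> ^ (2 * j)\<close>: 1 for the sines, -1 for
  the cosines.\<close>

definition lambert :: "nat \<Rightarrow> complex \<Rightarrow> complex \<Rightarrow> complex \<Rightarrow> complex" where
  "lambert e s \<rho> v = (\<Sum>k. s ^ k * kernel e (v * \<rho> ^ (2 * k + 1)))"

lemma one_plus_power_nonzero:
  fixes w :: complex
  assumes "norm w < 1" "e \<ge> 1"
  shows "1 + w ^ e \<noteq> 0"
proof
  assume "1 + w ^ e = 0"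
  hence "w ^ e = -1" by (simp add: add_eq_0_iff)
  hence "norm w ^ e = 1" by (metis norm_minus_cancel norm_one norm_power)
  moreover have "norm w ^ e < 1"
    using assms by (intro power_less_one_iff[THEN iffD2]) auto
  ultimately show False by simp
qed

lemma norm_kernel_le:
  assumes "norm w < 1" "e \<ge> 1"
  shows "norm (kernel e w) \<le> norm w / (1 - norm w)"
proof -
  have "norm w ^ e \<le> norm w"
    using assms power_decreasing[of 1 e "norm w"] by simp
  hence "1 - norm w \<le> norm (1 + w ^ e)"
    using norm_diff_ineq[of 1 "w ^ e"] by (simp add: norm_power)
  thus ?thesis
    unfolding kernel_def norm_divide using assms by (intro divide_left_mono frac_le) auto
qed

lemma kernel_sums:
  assumes "norm w < 1" "e \<ge> 1"
  shows "(\<lambda>n. (-1) ^ n * w ^ (e * n + 1)) sums kernel e w"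
proof -
  have "norm (- (w ^ e)) < 1"
    using assms by (auto simp: norm_power power_less_one_iff)
  from sums_mult[OF geometric_sums[OF this], of w]
  have "(\<lambda>n. w * (- (w ^ e)) ^ n) sums kernel e w" by (simp add: kernel_def)
  also have "(\<lambda>n. w * (- (w ^ e)) ^ n) = (\<lambda>n. (-1) ^ n * w ^ (e * n + 1))"
    unfolding power_minus[of "w ^ e"] power_add power_mult by (simp only: power_one_right mult_ac)
  finally show ?thesis .
qed

text \<open>The bound does not involve \<open>v\<close>, so it serves as majorant for the M-test on
  the whole unit disc.\<close>

lemma norm_lambert_term_le:
  assumes "norm v < 1" "norm \<rho> < 1" "norm s = 1" "e \<ge> 1"
  shows "norm (s ^ k * kernel e (v * \<rho> ^ (2 * k + 1))) \<le> norm \<rho> ^ k / (1 - norm \<rho>)"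
proof -
  define w where "w = v * \<rho> ^ (2 * k + 1)"
  have "norm \<rho> ^ (2 * k + 1) \<le> norm \<rho> ^ k" "norm \<rho> ^ (2 * k + 1) \<le> norm \<rho> ^ 1"
    using assms by (intro power_decreasing; simp)+
  moreover have "norm w \<le> norm \<rho> ^ (2 * k + 1)"
    unfolding w_def norm_mult norm_power using assms by (intro mult_left_le_one_le) auto
  ultimately have w: "norm w \<le> norm \<rho> ^ k" "norm w \<le> norm \<rho>" by auto
  have "norm (kernel e w) \<le> norm w / (1 - norm w)"
    using w assms by (intro norm_kernel_le) auto
  also have "\<dots> \<le> norm \<rho> ^ k / (1 - norm \<rho>)"
    using w assms by (intro frac_le) auto
  finally show ?thesis
    using assms by (simp add: w_def norm_mult norm_power)
qed

text \<open>Dropping the first \<open>N\<close> terms amounts to replacing \<open>v\<close> by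
  \<open>v * \<rho> ^ (2 * N)\<close>, which lies in the unit disc for large \<open>N\<close>.
  Points where a denominator vanishes are covered: such a term has the value 0.\<close>

lemma summable_lambert:
  assumes "norm \<rho> < 1" "norm s = 1" "e \<ge> 1"
  shows "summable (\<lambda>k. s ^ k * kernel e (v * \<rho> ^ (2 * k + 1)))"
proof -
  have small: "summable (\<lambda>k. s ^ k * kernel e (u * \<rho> ^ (2 * k + 1)))" if "norm u < 1" for u
  proof (rule summable_comparison_test')
    show "summable (\<lambda>k. norm \<rho> ^ k / (1 - norm \<rho>))"
      using assms by (intro summable_divide summable_geometric) auto
  qed (use norm_lambert_term_le assms that in blast)
  have "(\<lambda>N. norm v * norm \<rho> ^ N) \<longlonglongrightarrow> norm v * 0"
    using assms by (intro tendsto_mult tendsto_const LIMSEQ_power_zero) auto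
  hence "eventually (\<lambda>N. norm v * norm \<rho> ^ N < 1) sequentially"
    by (intro order_tendstoD) auto
  then obtain N where "\<forall>n\<ge>N. norm v * norm \<rho> ^ n < 1"
    by (auto simp: eventually_sequentially)
  hence "norm v * norm \<rho> ^ (2 * N) < 1" by simp
  hence "norm (v * \<rho> ^ (2 * N)) < 1" by (simp add: norm_mult norm_power)
  from summable_mult[OF small[OF this], of "s ^ N"]
  have "summable (\<lambda>k. s ^ (k + N) * kernel e (v * \<rho> ^ (2 * (k + N) + 1)))"
    by (simp add: power_add algebra_simps)
  thus ?thesis by (subst (asm) summable_iff_shift)
qed

text \<open>Multiplying \<open>v\<close> by \<open>\<rho>\<^sup>2\<close> shifts the summation index
  by one. This equation carries both the analytic continuation and the less visible of the two
  periods.\<close>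

lemma lambert_rec:
  assumes "norm \<rho> < 1" "norm s = 1" "e \<ge> 1"
  shows "lambert e s \<rho> v = kernel e (v * \<rho>) + s * lambert e s \<rho> (v * \<rho>\<^sup>2)"
proof -
  have "lambert e s \<rho> v =
          (\<Sum>k. s ^ Suc k * kernel e (v * \<rho> ^ (2 * Suc k + 1))) + kernel e (v * \<rho>)"
    using suminf_split_head[OF summable_lambert[OF assms], of v] unfolding lambert_def
    by (simp only: power_0 mult_0_right add_0 power_one_right mult_1_left diff_add_cancel)
  also have "(\<lambda>k. s ^ Suc k * kernel e (v * \<rho> ^ (2 * Suc k + 1))) =
               (\<lambda>k. s * (s ^ k * kernel e (v * \<rho>\<^sup>2 * \<rho> ^ (2 * k + 1))))"
    by (auto simp: power2_eq_square mult_ac)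
  also have "suminf \<dots> = s * lambert e s \<rho> (v * \<rho>\<^sup>2)"
    unfolding lambert_def by (rule suminf_mult[OF summable_lambert[OF assms]])
  finally show ?thesis by simp
qed

lemma analytic_kernel:
  assumes "1 + v ^ e \<noteq> 0"
  shows "kernel e analytic_on {v}"
  unfolding kernel_def using assms by (intro analytic_intros) auto

lemma analytic_lambert:
  assumes \<rho>: "norm \<rho> < 1" and s: "norm s = 1" and e: "e \<ge> 1"
    and v: "\<And>k. 1 + (v * \<rho> ^ (2 * k + 1)) ^ e \<noteq> 0"
  shows "lambert e s \<rho> analytic_on {v}"
proof -
  have unit_disc: "lambert e s \<rho> holomorphic_on ball 0 1"
  proof (rule holomorphic_uniform_sequence)
    fix n
    show "(\<lambda>v. \<Sum>k<n. s ^ k * kernel e (v * \<rho> ^ (2 * k + 1))) holomorphic_on ball 0 1"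
    proof (intro holomorphic_intros, unfold kernel_def, intro holomorphic_intros)
      fix k and v :: complex
      assume "v \<in> ball 0 1"
      hence "norm (v * \<rho> ^ (2 * k + 1)) < 1"
        using \<rho> mult_left_le[of "norm \<rho> ^ (2 * k + 1)" "norm v"]
          power_le_one[of "norm \<rho>" "2 * k + 1"]
        by (simp add: norm_mult norm_power del: power_Suc)
      thus "1 + (v * \<rho> ^ (2 * k + 1)) ^ e \<noteq> 0"
        by (rule one_plus_power_nonzero[OF _ e])
    qed
  next
    fix x :: complex assume "x \<in> ball 0 1"
    then obtain d where d: "d > 0" "cball x d \<subseteq> ball 0 1"
      using open_contains_cball by blast
    have "uniform_limit (cball x d) (\<lambda>n v. \<Sum>k<n. s ^ k * kernel e (v * \<rho> ^ (2 * k + 1)))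
            (lambert e s \<rho>) sequentially"
      unfolding lambert_def
    proof (rule Weierstrass_m_test)
      show "summable (\<lambda>k. norm \<rho> ^ k / (1 - norm \<rho>))"
        using \<rho> by (intro summable_divide summable_geometric) auto
    next
      fix n y assume "y \<in> cball x d"
      hence "norm y < 1" using d by auto
      thus "norm (s ^ n * kernel e (y * \<rho> ^ (2 * n + 1))) \<le> norm \<rho> ^ n / (1 - norm \<rho>)"
        by (rule norm_lambert_term_le) (use assms in auto)
    qed
    with d show "\<exists>d. 0 < d \<and> cball x d \<subseteq> ball 0 1 \<and>
        uniform_limit (cball x d) (\<lambda>n v. \<Sum>k<n. s ^ k * kernel e (v * \<rho> ^ (2 * k + 1)))
            (lambert e s \<rho>) sequentially" by blast
  qed auto
  \<comment> \<open>Continuation out of the disc: \<open>N\<close> counts the factors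
    \<open>\<rho>\<close> that bring \<open>v\<close> into it, and one use of
    \<open>lambert_rec\<close> replaces \<open>v\<close> by \<open>v * \<rho>\<^sup>2\<close> at the
    price of one kernel, analytic by the case \<open>k = 0\<close> of the second assumption.\<close>
  have ana: "lambert e s \<rho> analytic_on {v}"
    if "norm v * norm \<rho> ^ N < 1" "\<And>k. 1 + (v * \<rho> ^ (2 * k + 1)) ^ e \<noteq> 0" for N v
    using that
  proof (induction N arbitrary: v rule: less_induct)
    case (less N)
    show ?case
    proof (cases "N = 0")
      case True
      hence "v \<in> ball 0 1" using less.prems by simp
      thus ?thesis using unit_disc by (meson analytic_at open_ball)
    next
      case False
      have "lambert e s \<rho> analytic_on {v * \<rho>\<^sup>2}"
      proof (rule less.IH[of "N - 1"])
        have "norm (v * \<rho>\<^sup>2) * norm \<rho> ^ (N - 1) = norm v * norm \<rho> ^ N * norm \<rho>"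
          using False by (cases N) (auto simp: norm_mult norm_power power2_eq_square)
        also have "\<dots> \<le> norm v * norm \<rho> ^ N"
          using \<rho> by (intro mult_left_le) auto
        finally show "norm (v * \<rho>\<^sup>2) * norm \<rho> ^ (N - 1) < 1" using less.prems by simp
      next
        fix k show "1 + (v * \<rho>\<^sup>2 * \<rho> ^ (2 * k + 1)) ^ e \<noteq> 0"
          using less.prems(2)[of "Suc k"] by (simp add: power2_eq_square mult_ac)
      qed (use False in auto)
      hence "(lambert e s \<rho> \<circ> (\<lambda>v. v * \<rho>\<^sup>2)) analytic_on {v}"
        by (intro analytic_on_compose analytic_intros) auto
      moreover have "(kernel e \<circ> (\<lambda>v. v * \<rho>)) analytic_on {v}"
        using less.prems(2)[of 0] by (intro analytic_on_compose analytic_intros) (auto intro: analytic_kernel)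
      ultimately have "(\<lambda>v. kernel e (v * \<rho>) + s * lambert e s \<rho> (v * \<rho>\<^sup>2)) analytic_on {v}"
        unfolding o_def by (intro analytic_intros)
      also have "(\<lambda>v. kernel e (v * \<rho>) + s * lambert e s \<rho> (v * \<rho>\<^sup>2)) = lambert e s \<rho>"
        by (rule ext, rule lambert_rec[OF \<rho> s e, symmetric])
      finally show ?thesis .
    qed
  qed
  have "(\<lambda>N. norm v * norm \<rho> ^ N) \<longlonglongrightarrow> norm v * 0"
    using assms by (intro tendsto_mult tendsto_const LIMSEQ_power_zero) auto
  hence "eventually (\<lambda>N. norm v * norm \<rho> ^ N < 1) sequentially"
    by (intro order_tendstoD) auto
  then obtain N where "norm v * norm \<rho> ^ N < 1"
    by (auto simp: eventually_sequentially)
  thus ?thesis using ana v by blast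
qed

text \<open>Each kernel is a geometric series in \<open>n\<close>; for fixed \<open>n\<close> the
  sum over \<open>k\<close> is again geometric and produces the denominator. The condition on
  \<open>v * \<rho>\<close>, imposed for \<open>v\<close> and for \<open>inverse v\<close>, becomes
  the strip of the corresponding series.\<close>

lemma lambert_sums:
  assumes \<rho>: "norm \<rho> < 1" and s: "norm s = 1" and e: "e \<ge> 1" and v: "norm (v * \<rho>) < 1"
  shows "(\<lambda>n. (-1) ^ n * (v * \<rho>) ^ (e * n + 1) / (1 - s * \<rho> ^ (2 * (e * n + 1))))
           sums lambert e s \<rho> v"
  unfolding lambert_def
proof (rule sums_swap_geometric_bound)
  fix k n
  show "norm (s ^ k * ((-1) ^ n * (v * \<rho> ^ (2 * k + 1)) ^ (e * n + 1)))
          \<le> 1 * norm \<rho> ^ k * norm (v * \<rho>) ^ n"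
  proof -
    have "norm (v * \<rho>) ^ (e * n + 1) \<le> norm (v * \<rho>) ^ n"
    proof (rule power_decreasing)
      show "n \<le> e * n + 1" using e by (cases e) auto
    qed (use v in auto)
    moreover have "norm \<rho> ^ (2 * k * (e * n + 1)) \<le> norm \<rho> ^ k"
      using \<rho> by (intro power_decreasing) auto
    ultimately have "norm \<rho> ^ (2 * k * (e * n + 1)) * norm (v * \<rho>) ^ (e * n + 1)
                     \<le> norm \<rho> ^ k * norm (v * \<rho>) ^ n"
      by (intro mult_mono) auto
    also have "norm \<rho> ^ (2 * k * (e * n + 1)) * norm (v * \<rho>) ^ (e * n + 1) =
               norm (\<rho> ^ (2 * k) * (v * \<rho>)) ^ (e * n + 1)"
      unfolding norm_mult norm_power power_mult power_mult_distrib ..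
    finally show ?thesis
      using s by (simp add: norm_mult norm_power mult_ac)
  qed
next
  fix k
  have "norm (v * \<rho> ^ (2 * k + 1)) = norm (v * \<rho>) * norm \<rho> ^ (2 * k)"
    by (simp add: norm_mult norm_power)
  also have "\<dots> \<le> norm (v * \<rho>)"
    using \<rho> by (intro mult_left_le) (auto simp: power_le_one)
  finally have "norm (v * \<rho> ^ (2 * k + 1)) < 1" using v by simp
  from sums_mult[OF kernel_sums[OF this e], of "s ^ k"]
  show "(\<lambda>n. s ^ k * ((-1) ^ n * (v * \<rho> ^ (2 * k + 1)) ^ (e * n + 1)))
          sums (s ^ k * kernel e (v * \<rho> ^ (2 * k + 1)))" .
next
  fix n
  define j where "j = e * n + 1"
  have "norm (s * \<rho> ^ (2 * j)) < 1"
    using \<rho> s power_less_one_iff[of "norm \<rho>" "2 * j"]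
    by (simp add: norm_mult norm_power j_def del: power_Suc)
  from sums_mult[OF geometric_sums[OF this], of "(-1) ^ n * (v * \<rho>) ^ j"]
  moreover have "(-1) ^ n * (v * \<rho>) ^ j * (s * \<rho> ^ (2 * j)) ^ k =
                  s ^ k * ((-1) ^ n * (v * \<rho> ^ (2 * k + 1)) ^ j)" for k
  proof -
    have "(\<rho> ^ (2 * k + 1)) ^ j = \<rho> ^ j * (\<rho> ^ (2 * j)) ^ k"
      unfolding power_mult[symmetric] power_add[symmetric] by (simp add: algebra_simps)
    thus ?thesis by (simp only: power_mult_distrib mult_ac)
  qed
  ultimately show "(\<lambda>k. s ^ k * ((-1) ^ n * (v * \<rho> ^ (2 * k + 1)) ^ (e * n + 1))) sums
          ((-1) ^ n * (v * \<rho>) ^ (e * n + 1) / (1 - s * \<rho> ^ (2 * (e * n + 1))))"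
    unfolding j_def[symmetric]
    by simp
qed (use assms in auto)

subsection \<open>The infinite product\<close>

text \<open>The q-Pochhammer symbol \<open>(-v; q)\<close> with infinitely many factors.\<close>

definition qprod :: "complex \<Rightarrow> complex \<Rightarrow> complex" where
  "qprod q v = (\<Prod>n. 1 + v * q ^ n)"

text \<open>\<open>convergent_prod\<close> tolerates finitely many zero factors, so the zeros of the
  product are covered; \<open>has_prod\<close> gives the value 0 there.\<close>

lemma convergent_qprod:
  fixes q v :: complex
  assumes "norm q < 1"
  shows "convergent_prod (\<lambda>n. 1 + v * q ^ n)"
proof (rule abs_convergent_prod_imp_convergent_prod, rule summable_imp_abs_convergent_prod)
  show "summable (\<lambda>n. norm (1 + v * q ^ n - 1))"
    using assms by (auto simp: norm_mult norm_power intro!: summable_mult summable_geometric)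
qed

lemma has_prod_qprod:
  assumes "norm q < 1"
  shows "(\<lambda>n. 1 + v * q ^ n) has_prod qprod q v"
  unfolding qprod_def using convergent_qprod[OF assms] by (rule convergent_prod_has_prod)

lemma qprod_rec:
  assumes "norm q < 1"
  shows "qprod q v = (1 + v) * qprod q (v * q)"
proof -
  have "(\<lambda>n. 1 + v * q ^ Suc n) has_prod qprod q (v * q)"
    using has_prod_qprod[OF assms, of "v * q"] by (simp add: mult_ac)
  hence "(\<lambda>n. 1 + v * q ^ n) has_prod (qprod q (v * q) * (1 + v * q ^ 0))"
    by (rule has_prod_Suc_imp)
  thus ?thesis
    using has_prod_unique2[OF has_prod_qprod[OF assms, of v]] by (simp add: mult_ac)
qed

lemma qprod_eq_0_iff:
  assumes "norm q < 1"
  shows "qprod q v = 0 \<longleftrightarrow> (\<exists>n. 1 + v * q ^ n = 0)"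
  using has_prod_eq_0_iff[OF has_prod_qprod[OF assms, of v]] by auto

lemma holomorphic_qprod:
  assumes "norm q < 1"
  shows "qprod q holomorphic_on UNIV"
proof (rule holomorphic_uniform_sequence)
  fix n show "(\<lambda>v. \<Prod>k<n. 1 + v * q ^ k) holomorphic_on UNIV"
    by (intro holomorphic_intros)
next
  fix x :: complex
  have "uniformly_convergent_on (cball x 1) (\<lambda>N v. \<Prod>n<N. 1 + v * q ^ n)"
  proof (rule uniformly_convergent_on_prod)
    show "uniformly_convergent_on (cball x 1) (\<lambda>N v. \<Sum>n<N. norm (v * q ^ n))"
    proof (rule Weierstrass_m_test')
      fix n v assume "v \<in> cball x 1"
      hence "norm v \<le> norm x + 1"
        using norm_triangle_ineq2[of v x] by (simp add: dist_norm norm_minus_commute)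
      thus "norm (norm (v * q ^ n)) \<le> (norm x + 1) * norm q ^ n"
        by (simp add: norm_mult norm_power mult_right_mono)
    next
      show "summable (\<lambda>n. (norm x + 1) * norm q ^ n)"
        using assms by (intro summable_mult summable_geometric) auto
    qed
  qed (auto intro!: continuous_intros)
  hence "uniform_limit (cball x 1) (\<lambda>N v. \<Prod>n<N. 1 + v * q ^ n)
           (\<lambda>v. lim (\<lambda>N. \<Prod>n<N. 1 + v * q ^ n)) sequentially"
    by (simp add: uniformly_convergent_uniform_limit_iff)
  also have "(\<lambda>v. lim (\<lambda>N. \<Prod>n<N. 1 + v * q ^ n)) = qprod q"
  proof
    fix v
    have "(\<lambda>N. \<Prod>n\<le>N. 1 + v * q ^ n) \<longlonglongrightarrow> qprod q v"
      unfolding qprod_def using convergent_qprod[OF assms] by (rule convergent_prod_LIMSEQ)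
    hence "(\<lambda>N. \<Prod>n<N. 1 + v * q ^ n) \<longlonglongrightarrow> qprod q v"
      by (simp add: LIMSEQ_lessThan_iff_atMost)
    thus "lim (\<lambda>N. \<Prod>n<N. 1 + v * q ^ n) = qprod q v" by (rule limI)
  qed
  finally show "\<exists>d>0. cball x d \<subseteq> UNIV \<and>
      uniform_limit (cball x d) (\<lambda>N v. \<Prod>n<N. 1 + v * q ^ n) (qprod q) sequentially"
    by (intro exI[of _ 1]) auto
qed auto

subsection \<open>Functions with the quasi-periods and poles of cd\<close>

definition cd_poles :: "complex \<Rightarrow> complex set" where
  "cd_poles \<tau> = {z. \<exists>m n :: int. z = (1 + \<tau>) / 2 + of_int m + of_int n * \<tau>}"

text \<open>The functional equations are required at the poles too, so they also constrain the
  values that HOL assigns there. The limit at one pole bounds the order of every pole by 1, by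
  translation.\<close>

definition cd_like :: "complex \<Rightarrow> (complex \<Rightarrow> complex) \<Rightarrow> bool" where
  "cd_like \<tau> f \<longleftrightarrow>
     (\<forall>z. z \<notin> cd_poles \<tau> \<longrightarrow> f analytic_on {z}) \<and>
     (\<forall>z. f (z + 1) = - f z) \<and> (\<forall>z. f (z + \<tau>) = f z) \<and>
     ((\<lambda>z. (z - (1 + \<tau>) / 2) * f z) \<longlongrightarrow> - 1 / (4 * of_real pi)) (at ((1 + \<tau>) / 2))"

lemma cd_poles_shift:
  "z + of_int m + of_int n * \<tau> \<in> cd_poles \<tau> \<longleftrightarrow> z \<in> cd_poles \<tau>"
proof -
  have *: "z + of_int m + of_int n * \<tau> \<in> cd_poles \<tau>" if "z \<in> cd_poles \<tau>" for z m n
  proof -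
    from that obtain a b :: int where "z = (1 + \<tau>) / 2 + of_int a + of_int b * \<tau>"
      by (auto simp: cd_poles_def)
    hence "z + of_int m + of_int n * \<tau> = (1 + \<tau>) / 2 + of_int (a + m) + of_int (b + n) * \<tau>"
      by (simp add: algebra_simps)
    thus ?thesis unfolding cd_poles_def by blast
  qed
  show ?thesis
    using *[of z m n] *[of "z + of_int m + of_int n * \<tau>" "-m" "-n"] by auto
qed

text \<open>Poles in different rows differ by at least \<open>Im \<tau>\<close> in their imaginary
  parts, distinct poles in one row by a nonzero integer; hence the radius
  \<open>min 1 (Im \<tau>)\<close>.\<close>

lemma cd_poles_isolated:
  assumes "Im \<tau> > 0" "w \<in> cd_poles \<tau>" "z \<in> cd_poles \<tau>" "dist w z < min 1 (Im \<tau>)"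
  shows "z = w"
proof -
  obtain a b c d :: int where
    w: "w = (1 + \<tau>) / 2 + of_int a + of_int b * \<tau>" and
    z: "z = (1 + \<tau>) / 2 + of_int c + of_int d * \<tau>"
    using assms by (auto simp: cd_poles_def)
  define m n where "m = a - c" and "n = b - d"
  have wz: "w - z = of_int m + of_int n * \<tau>"
    by (simp add: w z m_def n_def algebra_simps)
  have lt: "norm (of_int m + of_int n * \<tau>) < min 1 (Im \<tau>)"
    using assms(4) unfolding dist_norm wz .
  have "\<bar>of_int n * Im \<tau>\<bar> < Im \<tau>"
    using lt abs_Im_le_cmod[of "of_int m + of_int n * \<tau>"] by simp
  hence "\<bar>of_int n :: real\<bar> * Im \<tau> < 1 * Im \<tau>"
    using assms(1) by (simp add: abs_mult)
  hence "\<bar>of_int n :: real\<bar> < 1"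
    using assms(1) by (simp only: mult_less_cancel_right_pos)
  hence n: "n = 0" by linarith
  have "\<bar>of_int m :: real\<bar> < 1" using lt n by simp
  hence "m = 0" by linarith
  with n wz show ?thesis by simp
qed

text \<open>The sign is \<open>(-1)^m\<close>. What matters later is that it does not depend on
  \<open>z\<close> and has norm 1.\<close>

lemma quasi_periodic_lattice:
  fixes f :: "complex \<Rightarrow> complex"
  assumes 1: "\<And>z. f (z + 1) = - f z" and \<tau>: "\<And>z. f (z + \<tau>) = f z"
  obtains s :: complex where "s = 1 \<or> s = -1" "\<And>z. f (z + of_int m + of_int n * \<tau>) = s * f z"
proof -
  have n: "f (z + of_int n * \<tau>) = f z" for z
  proof (induction n arbitrary: z rule: int_induct[of _ 0])
    case (step1 i)
    thus ?case using \<tau>[of "z + of_int i * \<tau>"] by (simp add: algebra_simps)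
  next
    case (step2 i)
    thus ?case using \<tau>[of "z + of_int (i - 1) * \<tau>"] by (simp add: algebra_simps)
  qed auto
  have "\<exists>s :: complex. (s = 1 \<or> s = -1) \<and> (\<forall>z. f (z + of_int m) = s * f z)"
  proof (induction m rule: int_induct[of _ 0])
    case (step1 i)
    then obtain s :: complex where s: "s = 1 \<or> s = -1" "\<forall>z. f (z + of_int i) = s * f z" by blast
    have "f (z + of_int (i + 1)) = - s * f z" for z
      using 1[of "z + of_int i"] s by (simp add: algebra_simps)
    thus ?case using s(1) by (intro exI[of _ "-s"]) auto
  next
    case (step2 i)
    then obtain s :: complex where s: "s = 1 \<or> s = -1" "\<forall>z. f (z + of_int i) = s * f z" by blast
    have "f (z + of_int (i - 1)) = - s * f z" for z
    proof -
      have "f (z + of_int i) = - f (z + of_int (i - 1))"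
        using 1[of "z + of_int (i - 1)"] by (simp add: algebra_simps)
      thus ?thesis using s by (metis minus_minus mult_minus_left)
    qed
    thus ?case using s(1) by (intro exI[of _ "-s"]) auto
  qed (auto intro: exI[of _ 1])
  then obtain s :: complex where "s = 1 \<or> s = -1" "\<And>z. f (z + of_int m) = s * f z" by blast
  with n that show thesis by metis
qed

lemma quasi_periodic_tendsto:
  fixes f :: "complex \<Rightarrow> complex"
  assumes 1: "\<And>z. f (z + 1) = - f z" and \<tau>: "\<And>z. f (z + \<tau>) = f z"
    and lim: "((\<lambda>z. (z - a) * f z) \<longlongrightarrow> c) (at a)"
    and w: "w = a + of_int m + of_int n * \<tau>"
  obtains s :: complex where "s = 1 \<or> s = -1" "((\<lambda>z. (z - w) * f z) \<longlongrightarrow> s * c) (at w)"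
proof -
  obtain s :: complex where s: "s = 1 \<or> s = -1"
      "\<And>z. f (z + of_int m + of_int n * \<tau>) = s * f z"
    using quasi_periodic_lattice[of f \<tau> m n, OF 1 \<tau>] by blast
  have "s * f (z + (a - w)) = f z" for z
    using s(2)[of "z + (a - w)"] by (simp add: w)
  hence "(\<lambda>z. s * ((z + (a - w) - a) * f (z + (a - w)))) = (\<lambda>z. (z - w) * f z)"
    by (simp add: mult.left_commute[of s])
  moreover have "((\<lambda>z. s * ((z + (a - w) - a) * f (z + (a - w)))) \<longlongrightarrow> s * c) (at w)"
    using LIM_offset[OF lim, of "a - w"] by (intro tendsto_mult_left) simp
  ultimately show thesis using that[OF s(1)] by (simp only:)
qed

lemma parallelogram_reduction:
  assumes "Im \<tau> > 0"
  obtains m n :: int and x y :: real where "0 \<le> x" "x \<le> 1" "0 \<le> y" "y \<le> 1"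
    "z + of_int m + of_int n * \<tau> = of_real x + of_real y * \<tau>"
proof -
  define b where "b = Im z / Im \<tau>"
  define a where "a = Re z - b * Re \<tau>"
  have z: "z = of_real a + of_real b * \<tau>"
    using assms by (simp add: complex_eq_iff a_def b_def)
  show thesis
  proof (rule that[of "frac a" "frac b" "- \<lfloor>a\<rfloor>" "- \<lfloor>b\<rfloor>"])
    show "z + of_int (- \<lfloor>a\<rfloor>) + of_int (- \<lfloor>b\<rfloor>) * \<tau> = of_real (frac a) + of_real (frac b) * \<tau>"
      unfolding z by (simp add: frac_def algebra_simps)
  qed (auto simp: less_imp_le[OF frac_lt_1])
qed

section \<open>Uniqueness by Liouville's theorem, and the nature of the poles\<close>

lemma cd_like_unique:
  assumes \<tau>: "Im \<tau> > 0" and f: "cd_like \<tau> f" and g: "cd_like \<tau> g" and z: "z \<notin> cd_poles \<tau>"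
  shows "f z = g z"
proof -
  define d where "d = (\<lambda>z. f z - g z)"
  define D where "D = remove_sings d"
  have ana: "d analytic_on {z}" if "z \<notin> cd_poles \<tau>" for z
    using f g that unfolding d_def cd_like_def by (intro analytic_intros) auto
  have d1: "d (z + 1) = - d z" and d\<tau>: "d (z + \<tau>) = d z" for z
    using f g by (auto simp: d_def cd_like_def)
  have lim0: "((\<lambda>z. (z - (1 + \<tau>) / 2) * d z) \<longlongrightarrow> 0) (at ((1 + \<tau>) / 2))"
    using tendsto_diff[of "\<lambda>z. (z - (1 + \<tau>) / 2) * f z" "- 1 / (4 * of_real pi)" _
        "\<lambda>z. (z - (1 + \<tau>) / 2) * g z" "- 1 / (4 * of_real pi)"] f g
    by (simp add: d_def cd_like_def right_diff_distrib)
  have D_eq: "D z = d z" if "z \<notin> cd_poles \<tau>" for z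
    unfolding D_def using ana[OF that] by (rule remove_sings_at_analytic)
  have nhd: "z \<notin> cd_poles \<tau>" if "w \<in> cd_poles \<tau>" "z \<in> ball w (min 1 (Im \<tau>)) - {w}" for z w
    using cd_poles_isolated[OF \<tau> that(1), of z] that by auto
  have D_ana: "D analytic_on {w}" for w
  proof (cases "w \<in> cd_poles \<tau>")
    case False
    thus ?thesis unfolding D_def by (intro remove_sings_analytic_on ana)
  next
    case True
    then obtain m n :: int where w: "w = (1 + \<tau>) / 2 + of_int m + of_int n * \<tau>"
      by (auto simp: cd_poles_def)
    \<comment> \<open>The residues of \<open>f\<close> and \<open>g\<close> cancel, so Riemann's
      theorem on removable singularities applies at every pole.\<close>
    have lim: "((\<lambda>z. (z - w) * d z) \<longlongrightarrow> 0) (at w)"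
      by (rule quasi_periodic_tendsto[OF d1 d\<tau> lim0 w]) auto
    have an: "d analytic_on (ball w (min 1 (Im \<tau>)) - {w})"
      using ana nhd[OF True] by (subst analytic_on_analytic_at) auto
    hence iso: "isolated_singularity_at d w"
      unfolding isolated_singularity_at_def using \<tau> by (intro exI[of _ "min 1 (Im \<tau>)"]) auto
    have "\<exists>h. h holomorphic_on ball w (min 1 (Im \<tau>)) \<and> (\<forall>z\<in>ball w (min 1 (Im \<tau>)) - {w}. h z = d z)"
      using holomorphic_on_extend_lim[of d "ball w (min 1 (Im \<tau>))" w] lim \<tau>
        analytic_imp_holomorphic[OF an] by simp
    then obtain h where h: "h holomorphic_on ball w (min 1 (Im \<tau>))"
      "\<And>z. z \<in> ball w (min 1 (Im \<tau>)) - {w} \<Longrightarrow> h z = d z" by blast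
    have "isCont h w"
      using h(1) \<tau> holomorphic_on_imp_continuous_on continuous_on_eq_continuous_at[of "ball w (min 1 (Im \<tau>))" h]
      by auto
    hence "(h \<longlongrightarrow> h w) (at w)" by (simp add: isCont_def)
    moreover have "eventually (\<lambda>z. h z = d z) (at w)"
      using eventually_at_in_open[of "ball w (min 1 (Im \<tau>))" w] \<tau>
      by (auto elim!: eventually_mono intro: h(2))
    ultimately have "(d \<longlongrightarrow> h w) (at w)" by (rule Lim_transform_eventually)
    thus ?thesis unfolding D_def by (intro remove_sings_analytic_at iso)
  qed
  hence D_UNIV: "D analytic_on UNIV" using analytic_on_analytic_at by blast
  hence D_hol: "D holomorphic_on UNIV" by (rule analytic_imp_holomorphic)
  hence D_cont: "continuous_on UNIV D" by (rule holomorphic_on_imp_continuous_on)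
  define K where "K = (\<lambda>(x, y). of_real x + of_real y * \<tau>) ` ({0..1::real} \<times> {0..1::real})"
  have "compact K"
    unfolding K_def by (intro compact_continuous_image compact_Times)
      (auto intro!: continuous_intros simp: case_prod_unfold)
  hence "bounded (D ` K)"
    by (intro compact_imp_bounded compact_continuous_image continuous_on_subset[OF D_cont]) auto
  then obtain B where "\<forall>x\<in>D ` K. norm x \<le> B"
    unfolding bounded_iff ..
  hence B: "norm (D z) \<le> B" if "z \<in> K" for z
    using that by simp
  \<comment> \<open>The functional equations are known for \<open>d\<close>, and \<open>D\<close>
    agrees with \<open>d\<close> only off the poles. Translation to the compact parallelogram
    \<open>K\<close> is therefore done there, and at the poles the bound follows from the continuity
    of \<open>D\<close>.\<close>
  have off: "norm (D z) \<le> B" if z: "z \<notin> cd_poles \<tau>" for z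
  proof -
    obtain m n :: int and x y :: real where *: "0 \<le> x" "x \<le> 1" "0 \<le> y" "y \<le> 1"
      "z + of_int m + of_int n * \<tau> = of_real x + of_real y * \<tau>"
      by (rule parallelogram_reduction[OF \<tau>, of z])
    obtain s :: complex where s: "s = 1 \<or> s = -1" "\<And>z. d (z + of_int m + of_int n * \<tau>) = s * d z"
      by (rule quasi_periodic_lattice[of d \<tau> m n, OF d1 d\<tau>]) (rule that)
    have "z + of_int m + of_int n * \<tau> \<in> K"
      unfolding *(5) K_def by (rule image_eqI[of _ _ "(x, y)"]) (use * in auto)
    hence "norm (D (z + of_int m + of_int n * \<tau>)) \<le> B" by (rule B)
    also have "D (z + of_int m + of_int n * \<tau>) = s * d z"
      using D_eq[of "z + of_int m + of_int n * \<tau>"] z s(2) by (simp add: cd_poles_shift)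
    also have "norm (s * d z) = norm (D z)"
      using s(1) D_eq[OF z] by auto
    finally show ?thesis .
  qed
  have "norm (D w) \<le> B" for w
  proof (cases "w \<in> cd_poles \<tau>")
    case True
    have "((\<lambda>z. norm (D z)) \<longlongrightarrow> norm (D w)) (at w)"
      using D_cont by (intro tendsto_norm) (simp add: continuous_on_eq_continuous_at isCont_def)
    moreover have "eventually (\<lambda>z. norm (D z) \<le> B) (at w)"
      using eventually_at_in_open[of "ball w (min 1 (Im \<tau>))" w] \<tau>
      by (auto elim!: eventually_mono intro!: off nhd[OF True])
    ultimately show ?thesis by (rule tendsto_upperbound) auto
  qed (rule off)
  hence "bounded (range D)" unfolding bounded_iff by auto
  with D_hol have "D constant_on UNIV" by (rule Liouville_theorem)
  then obtain c where c: "\<And>z. D z = c"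
    unfolding constant_on_def by auto
  have "d (z + 1) = c" "d z = c"
    using c D_eq[OF z] D_eq[of "z + 1"] cd_poles_shift[of z 1 0 \<tau>] z by auto
  with d1[of z] have "c = 0" by simp
  with \<open>d z = c\<close> show ?thesis by (simp add: d_def)
qed

lemma cd_like_tendsto_at_pole:
  assumes "cd_like \<tau> f" "w \<in> cd_poles \<tau>"
  obtains c where "c \<noteq> 0" "((\<lambda>z. (z - w) * f z) \<longlongrightarrow> c) (at w)"
proof -
  obtain m n :: int where w: "w = (1 + \<tau>) / 2 + of_int m + of_int n * \<tau>"
    using assms(2) by (auto simp: cd_poles_def)
  have f: "\<And>z. f (z + 1) = - f z" "\<And>z. f (z + \<tau>) = f z"
      "((\<lambda>z. (z - (1 + \<tau>) / 2) * f z) \<longlongrightarrow> - 1 / (4 * of_real pi)) (at ((1 + \<tau>) / 2))"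
    using assms(1) unfolding cd_like_def by auto
  obtain s :: complex where "s = 1 \<or> s = -1"
    "((\<lambda>z. (z - w) * f z) \<longlongrightarrow> s * (- 1 / (4 * of_real pi))) (at w)"
    using quasi_periodic_tendsto[OF f w] by blast
  moreover from this have "s * (- 1 / (4 * of_real pi)) \<noteq> 0" by auto
  ultimately show thesis using that by blast
qed

text \<open>\<open>f\<close> is the product of \<open>(z - w) * f z\<close>, with nonzero limit, and
  \<open>inverse (z - w)\<close>, which tends to infinity.\<close>

lemma is_pole_if_simple:
  fixes f :: "complex \<Rightarrow> complex"
  assumes "((\<lambda>z. (z - w) * f z) \<longlongrightarrow> c) (at w)" "c \<noteq> 0"
  shows "is_pole f w"
proof -
  have "filterlim (\<lambda>z. z - w) (at 0) (at w)"
    by (auto simp: filterlim_at eventually_at intro!: tendsto_eq_intros exI[of _ 1])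
  hence "filterlim (\<lambda>z. inverse (z - w)) at_infinity (at w)"
    by (rule filterlim_compose[OF filterlim_inverse_at_infinity])
  hence "filterlim (\<lambda>z. (z - w) * f z * inverse (z - w)) at_infinity (at w)"
    using assms by (intro tendsto_mult_filterlim_at_infinity)
  moreover have "eventually (\<lambda>z. (z - w) * f z * inverse (z - w) = f z) (at w)"
    by (auto simp: eventually_at intro!: exI[of _ 1])
  ultimately show ?thesis unfolding is_pole_def by (subst (asm) filterlim_cong) auto
qed

lemma cd_like_is_pole:
  assumes "cd_like \<tau> f" "w \<in> cd_poles \<tau>"
  shows "is_pole f w"
  by (rule cd_like_tendsto_at_pole[OF assms]) (rule is_pole_if_simple)

lemma cd_like_nicely_meromorphic:
  assumes \<tau>: "Im \<tau> > 0" and f: "cd_like \<tau> f" and 0: "\<And>w. w \<in> cd_poles \<tau> \<Longrightarrow> f w = 0"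
  shows "f nicely_meromorphic_on UNIV"
proof (rule nicely_meromorphic_onI_open[where pts = "cd_poles \<tau>"])
  show "f analytic_on UNIV - cd_poles \<tau>"
    using f unfolding cd_like_def by (subst analytic_on_analytic_at) auto
  show "is_pole f x \<and> f x = 0" if "x \<in> cd_poles \<tau>" for x
    using cd_like_is_pole[OF f that] 0[OF that] by simp
  show "isolated_singularity_at f w" for w
  proof (cases "w \<in> cd_poles \<tau>")
    case True
    have "f analytic_on (ball w (min 1 (Im \<tau>)) - {w})"
    proof (subst analytic_on_analytic_at, rule ballI)
      fix z assume z: "z \<in> ball w (min 1 (Im \<tau>)) - {w}"
      hence "z \<notin> cd_poles \<tau>" using cd_poles_isolated[OF \<tau> True, of z] by auto
      thus "f analytic_on {z}" using f by (simp add: cd_like_def)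
    qed
    thus ?thesis
      unfolding isolated_singularity_at_def using \<tau> by (intro exI[of _ "min 1 (Im \<tau>)"]) auto
  next
    case False
    hence "f analytic_on {w}" using f by (simp add: cd_like_def)
    thus ?thesis by (rule isolated_singularity_at_analytic)
  qed
qed auto

section \<open>The identity theorem for normalised meromorphic functions\<close>

text \<open>The difference \<open>F - G\<close> need not be normalised: where principal parts
  cancel, its value is 0 whatever its limit. The identity theorem is therefore applied to
  \<open>remove_sings\<close> of it, which gives agreement on punctured neighbourhoods; the values
  are compared afterwards.\<close>

lemma nicely_meromorphic_eqI:
  assumes F: "F nicely_meromorphic_on UNIV" and G: "G nicely_meromorphic_on UNIV"
    and U: "open U" "U \<noteq> {}" "\<And>z. z \<in> U \<Longrightarrow> F z = G z"
  shows "F = G"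
proof
  fix z
  have mero: "(\<lambda>z. F z - G z) meromorphic_on UNIV"
    using F G unfolding nicely_meromorphic_on_def by (intro meromorphic_intros) auto
  define D where "D = remove_sings (\<lambda>z. F z - G z)"
  have D: "D nicely_meromorphic_on UNIV"
    unfolding D_def using mero by (rule remove_sings_nicely_meromorphic)
  have D_U: "D x = 0" if "x \<in> U" for x
    unfolding D_def
  proof (rule remove_sings_eqI)
    have "eventually (\<lambda>z. z \<in> U) (at x)"
      using U(1) that by (simp add: eventually_at_in_open')
    hence "eventually (\<lambda>z. 0 = F z - G z) (at x)"
      by eventually_elim (use U in auto)
    thus "((\<lambda>z. F z - G z) \<longlongrightarrow> 0) (at x)"
      by (rule Lim_transform_eventually[OF tendsto_const])
  qed
  have "D constant_on UNIV"
    by (rule constant_on_extend_nicely_meromorphic_on[OF D, of U])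
       (use U D_U in \<open>auto simp: constant_on_def\<close>)
  hence D0: "D x = 0" for x using D_U U(2) by (auto simp: constant_on_def)
  have "eventually (\<lambda>w. D w = F w - G w) (at z)"
    unfolding D_def using meromorphic_on_subset[OF mero]
    by (intro eventually_remove_sings_eq_at meromorphic_on_isolated_singularity) auto
  hence ev: "eventually (\<lambda>w. F w = G w) (at z)"
    by eventually_elim (simp add: D0)
  have F': "is_pole F z \<and> F z = 0 \<or> F \<midarrow>z\<rightarrow> F z" and G': "is_pole G z \<and> G z = 0 \<or> G \<midarrow>z\<rightarrow> G z"
    using F G unfolding nicely_meromorphic_on_def by auto
  have pole: "is_pole F z \<longleftrightarrow> is_pole G z" using ev by (intro is_pole_cong) auto
  have nlim: "\<not> H \<midarrow>z\<rightarrow> H z" if "is_pole H z" for H :: "complex \<Rightarrow> complex"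
    using that not_tendsto_and_filterlim_at_infinity[of "at z" H] unfolding is_pole_def by auto
  show "F z = G z"
  \<comment> \<open>Near \<open>z\<close> the two functions agree, so both have a pole there, with
    value 0, or both values are the common limit.\<close>
  proof (cases "is_pole F z")
    case True
    with F' G' pole nlim[of F] nlim[of G] show ?thesis by simp
  next
    case False
    hence "F \<midarrow>z\<rightarrow> F z" "G \<midarrow>z\<rightarrow> G z" using F' G' pole by simp_all
    with tendsto_cong[OF ev, of "G z"] have "F \<midarrow>z\<rightarrow> G z" by blast
    with \<open>F \<midarrow>z\<rightarrow> F z\<close> show ?thesis by (rule LIM_unique)
  qed
qed

lemma cd_poles_closed:
  assumes "Im \<tau> > 0"
  shows "closed (cd_poles \<tau>)"
proof (rule discrete_imp_closed)
  show "\<forall>x\<in>cd_poles \<tau>. \<forall>y\<in>cd_poles \<tau>. dist y x < min 1 (Im \<tau>) \<longrightarrow> y = x"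
    using cd_poles_isolated[OF assms] by metis
qed (use assms in auto)

text \<open>Setting the value at the poles to 0 is the normalisation of \<open>nicely_meromorphic_on\<close>; it also
  repairs the antiperiodicity of \<open>cd_tan\<close>, which fails at the poles under the convention \<open>x / 0 = 0\<close>.\<close>

lemma cd_likeI:
  assumes \<tau>: "Im \<tau> > 0"
    and ana: "\<And>z. z \<notin> cd_poles \<tau> \<Longrightarrow> f analytic_on {z}"
    and 1: "\<And>z. z \<notin> cd_poles \<tau> \<Longrightarrow> f (z + 1) = - f z"
    and 2: "\<And>z. z \<notin> cd_poles \<tau> \<Longrightarrow> f (z + \<tau>) = f z"
    and lim: "((\<lambda>z. (z - (1 + \<tau>) / 2) * f z) \<longlongrightarrow> - 1 / (4 * of_real pi)) (at ((1 + \<tau>) / 2))"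
  shows "cd_like \<tau> (\<lambda>z. if z \<in> cd_poles \<tau> then 0 else f z)" (is "cd_like \<tau> ?g")
  unfolding cd_like_def
proof (intro conjI allI impI)
  fix z assume z: "z \<notin> cd_poles \<tau>"
  have "eventually (\<lambda>w. w \<in> - cd_poles \<tau>) (nhds z)"
    using z cd_poles_closed[OF \<tau>] by (intro eventually_nhds_in_open) auto
  hence "eventually (\<lambda>w. ?g w = f w) (nhds z)"
    by eventually_elim auto
  thus "?g analytic_on {z}" using ana[OF z] by (subst analytic_at_cong) auto
next
  fix z show "?g (z + 1) = - ?g z"
    using 1[of z] cd_poles_shift[of z 1 0 \<tau>] by auto
next
  fix z show "?g (z + \<tau>) = ?g z"
    using 2[of z] cd_poles_shift[of z 0 1 \<tau>] by auto
next
  have mem: "(1 + \<tau>) / 2 \<in> cd_poles \<tau>"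
    unfolding cd_poles_def by (rule CollectI, rule exI[of _ 0], rule exI[of _ 0]) simp
  have "eventually (\<lambda>z. z \<in> ball ((1 + \<tau>) / 2) (min 1 (Im \<tau>)) - {(1 + \<tau>) / 2}) (at ((1 + \<tau>) / 2))"
    using \<tau> by (intro eventually_at_in_open) auto
  hence "eventually (\<lambda>z. (z - (1 + \<tau>) / 2) * f z = (z - (1 + \<tau>) / 2) * ?g z) (at ((1 + \<tau>) / 2))"
  proof eventually_elim
    case (elim z)
    thus ?case using cd_poles_isolated[OF \<tau> mem, of z] by auto
  qed
  with lim show "((\<lambda>z. (z - (1 + \<tau>) / 2) * ?g z) \<longlongrightarrow> - 1 / (4 * of_real pi)) (at ((1 + \<tau>) / 2))"
    by (rule Lim_transform_eventually)
qed

section \<open>Zeros of the denominators\<close>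

lemma exp_eq_minus_1D:
  assumes "1 + exp (2 * \<i> * of_real pi * w) = 0"
  obtains m :: int where "w = 1 / 2 + of_int m"
proof -
  have "exp (2 * \<i> * of_real pi * w) = exp (\<i> * of_real pi)"
    using assms by (simp add: add_eq_0_iff)
  then obtain m :: int where "2 * \<i> * of_real pi * w = \<i> * of_real pi + (of_int (2 * m) * pi) * \<i>"
    unfolding exp_eq by blast
  hence "(2 * \<i> * of_real pi) * w = (2 * \<i> * of_real pi) * (1 / 2 + of_int m)"
    by (simp add: algebra_simps)
  hence "w = 1 / 2 + of_int m" by (subst (asm) mult_cancel_left) auto
  thus thesis by (rule that)
qed

text \<open>\<open>- (1 + \<tau>) / 2\<close> differs from \<open>(1 + \<tau>) / 2\<close> by the
  period \<open>1 + \<tau>\<close>. By this symmetry, statements about \<open>exp (- ...)\<close>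
  follow from those about \<open>exp\<close> at \<open>- z\<close>.\<close>

lemma cd_poles_minus: "- z \<in> cd_poles \<tau> \<Longrightarrow> z \<in> cd_poles \<tau>"
proof -
  assume "- z \<in> cd_poles \<tau>"
  then obtain a b :: int where "- z = (1 + \<tau>) / 2 + of_int a + of_int b * \<tau>"
    by (auto simp: cd_poles_def)
  hence "z = - ((1 + \<tau>) / 2 + of_int a + of_int b * \<tau>)" by (metis minus_minus)
  hence "z = (1 + \<tau>) / 2 + of_int (- a - 1) + of_int (- b - 1) * \<tau>"
    by (simp add: field_simps)
  thus ?thesis unfolding cd_poles_def by blast
qed

text \<open>Locates the zeros of the denominators of \<open>cd_sec\<close> and of those of the
  product; \<open>in_cd_polesI'\<close> does the same for \<open>cd_tan\<close>.\<close>

lemma in_cd_polesI: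
  assumes "1 + exp (2 * \<i> * of_real pi * (z + \<tau> / 2 + of_int k * \<tau>)) = 0"
  shows "z \<in> cd_poles \<tau>"
proof -
  from assms obtain m :: int where "z + \<tau> / 2 + of_int k * \<tau> = 1 / 2 + of_int m"
    by (rule exp_eq_minus_1D)
  hence "z = 1 / 2 + of_int m - (\<tau> / 2 + of_int k * \<tau>)" by (simp add: eq_diff_eq add.assoc)
  also have "\<dots> = (1 + \<tau>) / 2 + of_int m + of_int (- k - 1) * \<tau>" by (simp add: field_simps)
  finally show ?thesis unfolding cd_poles_def by blast
qed

lemma in_cd_polesI':
  assumes "\<tau> \<noteq> 0" "1 + exp (2 * \<i> * of_real pi * ((z - 1 / 2 - of_int k) / \<tau>)) = 0"
  shows "z \<in> cd_poles \<tau>"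
proof -
  from assms(2) obtain m :: int where "(z - 1 / 2 - of_int k) / \<tau> = 1 / 2 + of_int m"
    by (rule exp_eq_minus_1D)
  hence "z - 1 / 2 - of_int k = (1 / 2 + of_int m) * \<tau>"
    using assms(1) by (simp add: divide_eq_eq)
  hence "z = (1 / 2 + of_int m) * \<tau> + 1 / 2 + of_int k" by (simp add: algebra_simps)
  also have "\<dots> = (1 + \<tau>) / 2 + of_int k + of_int m * \<tau>" by (simp add: field_simps)
  finally show ?thesis unfolding cd_poles_def by blast
qed

text \<open>The denominator vanishes at \<open>w\<close> with derivative \<open>- a\<close>. All
  three residues are computed from this limit.\<close>

lemma tendsto_divide_one_plus_exp:
  fixes a b w :: complex
  assumes "exp (a * w + b) = -1" "a \<noteq> 0"
  shows "((\<lambda>z. (z - w) / (1 + exp (a * z + b))) \<longlongrightarrow> - 1 / a) (at w)"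
proof -
  have "((\<lambda>z. a * z + b) has_field_derivative a) (at w)"
    by (auto intro!: derivative_eq_intros)
  from DERIV_fun_exp[OF this]
  have "((\<lambda>z. exp (a * z + b)) has_field_derivative - a) (at w)"
    by (simp add: assms)
  hence "((\<lambda>z. (exp (a * z + b) - exp (a * w + b)) / (z - w)) \<longlongrightarrow> - a) (at w)"
    by (simp add: has_field_derivative_iff)
  hence "((\<lambda>z. (1 + exp (a * z + b)) / (z - w)) \<longlongrightarrow> - a) (at w)"
    unfolding assms(1) by (simp add: add.commute)
  from tendsto_inverse[OF this] assms(2) show ?thesis
    by (simp add: inverse_eq_divide)
qed

subsection \<open>The trigonometric series\<close>

text \<open>The two trigonometric series of \<open>is_CD\<close> after the exchange of summations: \<open>cd_sec\<close> continues the
  one in \<open>cos ((2n + 1) \<pi> z)\<close>, \<open>cd_tan\<close> the one in \<open>cos (2n \<pi> z / \<tau>)\<close>.\<close>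

definition cd_sec :: "complex \<Rightarrow> complex \<Rightarrow> complex" where
  "cd_sec \<tau> z =
     (lambert 2 1 (exp (\<i> * of_real pi * \<tau> / 2)) (exp (\<i> * of_real pi * z)) +
      lambert 2 1 (exp (\<i> * of_real pi * \<tau> / 2)) (exp (- (\<i> * of_real pi * z)))) / 2"

definition cd_tan :: "complex \<Rightarrow> complex \<Rightarrow> complex" where
  "cd_tan \<tau> z = \<i> / (4 * \<tau>) * (1 - 2 *
     (lambert 1 (-1) (exp (- (\<i> * of_real pi / \<tau>))) (exp (2 * \<i> * of_real pi * z / \<tau>)) +
      lambert 1 (-1) (exp (- (\<i> * of_real pi / \<tau>))) (exp (- (2 * \<i> * of_real pi * z / \<tau>)))))"

lemma kernel_2_minus: "kernel 2 (- w) = - kernel 2 w"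
  by (simp add: kernel_def)

text \<open>For nonzero \<open>w\<close> the kernel is \<open>1 / (w + 1 / w)\<close>. The symmetry
  lets a term leave one half of the bilateral sum and enter the other.\<close>

lemma kernel_2_inverse: "kernel 2 (inverse w) = kernel 2 w"
proof (cases "w = 0")
  case False
  hence "1 + (inverse w)\<^sup>2 = (1 + w\<^sup>2) / w\<^sup>2"
    by (simp add: field_simps)
  thus ?thesis using False by (simp add: kernel_def field_simps power2_eq_square)
qed (simp add: kernel_def)

lemma kernel_1_inverse:
  assumes "w \<noteq> 0" "1 + w \<noteq> 0"
  shows "kernel 1 w + kernel 1 (inverse w) = 1"
proof -
  have "1 + inverse w = (1 + w) / w" using assms by (simp add: field_simps)
  hence "kernel 1 (inverse w) = 1 / (1 + w)" using assms by (simp add: kernel_def field_simps)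
  thus ?thesis using assms by (simp add: kernel_def flip: add_divide_distrib)
qed

lemma lambert_2_minus: "norm \<rho> < 1 \<Longrightarrow> lambert 2 1 \<rho> (- v) = - lambert 2 1 \<rho> v"
  unfolding lambert_def using summable_lambert[of \<rho> 1 2 v]
  by (subst suminf_minus[symmetric]) (simp_all add: kernel_2_minus)

lemma analytic_lambert_compose:
  assumes "norm \<rho> < 1" "norm s = 1" "e \<ge> 1" "f analytic_on {z}"
    and "\<And>k. 1 + (f z * \<rho> ^ (2 * k + 1)) ^ e \<noteq> 0"
  shows "(\<lambda>z. lambert e s \<rho> (f z)) analytic_on {z}"
  using analytic_on_compose[OF assms(4), of "lambert e s \<rho>"] analytic_lambert[of \<rho> s e "f z"] assms
  by (simp add: o_def)

text \<open>Meant for the residue computations: once the singular term is split off, the remaining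
  arguments at \<open>(1 + \<tau>) / 2\<close> lie in the unit disc.\<close>

lemma analytic_lambert_compose_disc:
  assumes "norm \<rho> < 1" "norm s = 1" "e \<ge> 1" "f analytic_on {z}" "norm (f z) < 1"
  shows "(\<lambda>z. lambert e s \<rho> (f z)) analytic_on {z}"
proof (rule analytic_lambert_compose)
  fix k
  have "norm (f z) * norm \<rho> ^ (2 * k + 1) \<le> norm (f z)"
    using assms by (intro mult_left_le power_le_one) auto
  thus "1 + (f z * \<rho> ^ (2 * k + 1)) ^ e \<noteq> 0"
    using assms by (intro one_plus_power_nonzero) (simp_all add: norm_mult norm_power)
qed (use assms in auto)

lemma cd_sec_cd_like:
  assumes \<tau>: "Im \<tau> > 0"
  shows "cd_like \<tau> (\<lambda>z. if z \<in> cd_poles \<tau> then 0 else cd_sec \<tau> z)"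
proof (rule cd_likeI[OF \<tau>])
  define r where "r = exp (\<i> * of_real pi * \<tau> / 2)"
  have r: "norm r < 1" "r \<noteq> 0" using \<tau> by (simp_all add: r_def)
  have pw: "(exp (\<i> * of_real pi * z) * r ^ (2 * k + 1)) ^ 2 =
              exp (2 * \<i> * of_real pi * (z + \<tau> / 2 + of_int (int k) * \<tau>))" for z k
    unfolding r_def exp_of_nat_mult[symmetric] exp_add[symmetric]
    by (intro arg_cong[of _ _ exp]) (simp add: field_simps)
  have nz: "1 + (exp (\<i> * of_real pi * z) * r ^ (2 * k + 1)) ^ 2 \<noteq> 0" if "z \<notin> cd_poles \<tau>" for z k
    using that in_cd_polesI[of z \<tau> "int k"] unfolding pw by blast
  have nz': "1 + (exp (- (\<i> * of_real pi * z)) * r ^ (2 * k + 1)) ^ 2 \<noteq> 0" if "z \<notin> cd_poles \<tau>" for z k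
    using nz[of "- z" k] that cd_poles_minus by fastforce
  have rec: "lambert 2 1 r v = kernel 2 (v * r) + lambert 2 1 r (v * r\<^sup>2)" for v
    using lambert_rec[of r 1 2 v] r by simp
  {
    fix z assume z: "z \<notin> cd_poles \<tau>"
    show "cd_sec \<tau> analytic_on {z}"
      unfolding cd_sec_def r_def[symmetric] using r nz[OF z] nz'[OF z]
      by (intro analytic_intros analytic_lambert_compose) auto
  next
    fix z
    have 1: "exp (\<i> * of_real pi * (z + 1)) = - exp (\<i> * of_real pi * z)"
      by (simp add: distrib_left exp_add)
    hence 2: "exp (- (\<i> * of_real pi * (z + 1))) = - exp (- (\<i> * of_real pi * z))"
      by (simp add: exp_minus)
    show "cd_sec \<tau> (z + 1) = - cd_sec \<tau> z"
      unfolding cd_sec_def r_def[symmetric] 1 2 lambert_2_minus[OF r(1)]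
      by (simp add: field_simps)
  next
    fix z
    define u where "u = exp (\<i> * of_real pi * z)"
    have u: "u \<noteq> 0" by (simp add: u_def)
    have u': "exp (- (\<i> * of_real pi * z)) = inverse u" by (simp add: u_def exp_minus)
    have "exp (\<i> * of_real pi * (z + \<tau>)) = u * r\<^sup>2"
      unfolding u_def r_def exp_double[symmetric] exp_add[symmetric]
      by (intro arg_cong[of _ _ exp]) (simp add: field_simps)
    moreover from this have "exp (- (\<i> * of_real pi * (z + \<tau>))) = inverse (u * r\<^sup>2)"
      by (simp only: exp_minus)
    ultimately have "cd_sec \<tau> (z + \<tau>) = (lambert 2 1 r (u * r\<^sup>2) + lambert 2 1 r (inverse (u * r\<^sup>2))) / 2"
      by (simp only: cd_sec_def r_def[symmetric])
    \<comment> \<open>The shift by \<open>\<tau>\<close> removes \<open>kernel 2 (u * r)\<close>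
      from the first sum and adds the kernel at the inverse point to the second; these are
      equal.\<close>
    also have "lambert 2 1 r (inverse (u * r\<^sup>2)) = kernel 2 (inverse (u * r)) + lambert 2 1 r (inverse u)"
      using rec[of "inverse (u * r\<^sup>2)"] r u by (simp add: field_simps power2_eq_square)
    also have "kernel 2 (inverse (u * r)) = kernel 2 (u * r)" by (rule kernel_2_inverse)
    also have "lambert 2 1 r (u * r\<^sup>2) + (kernel 2 (u * r) + lambert 2 1 r (inverse u)) =
                 lambert 2 1 r u + lambert 2 1 r (inverse u)"
      using rec[of u] by simp
    finally show "cd_sec \<tau> (z + \<tau>) = cd_sec \<tau> z"
      unfolding cd_sec_def r_def[symmetric] u_def[symmetric] u' .
  next
    define a where "a = (1 + \<tau>) / 2"
    \<comment> \<open>Only the term \<open>k = 0\<close> of the second sum is singular at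
      \<open>a\<close>. Its numerator tends to \<open>-\<i>\<close> and \<open>(z - a) / g z\<close>
      to \<open>1 / (2 * \<i> * pi)\<close>; with the factor 1/2 this gives
      \<open>- 1 / (4 * pi)\<close>.\<close>
    define g where "g = (\<lambda>z. 1 + exp (- (2 * \<i> * of_real pi) * z + \<i> * of_real pi * \<tau>))"
    have "- (2 * \<i> * of_real pi) * a + \<i> * of_real pi * \<tau> = - (\<i> * of_real pi)"
      by (simp add: a_def field_simps)
    hence "exp (- (2 * \<i> * of_real pi) * a + \<i> * of_real pi * \<tau>) = -1"
      by (simp only: exp_minus) simp
    note * = tendsto_divide_one_plus_exp[OF this]
    define p where "p = (\<lambda>z. (z - a) / g z)"
    have lim: "(p \<longlongrightarrow> 1 / (2 * \<i> * of_real pi)) (at a)"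
      unfolding p_def g_def using * by simp
    define h where "h = (\<lambda>z. lambert 2 1 r (exp (\<i> * of_real pi * z)) +
                           lambert 2 1 r (exp (- (\<i> * of_real pi * z)) * r\<^sup>2))"
    have split: "(z - a) * cd_sec \<tau> z =
        (exp (- (\<i> * of_real pi * z)) * r * p z + (z - a) * h z) / 2" for z
    proof -
      have "(exp (- (\<i> * of_real pi * z)) * r)\<^sup>2 = exp (- (2 * \<i> * of_real pi) * z + \<i> * of_real pi * \<tau>)"
        unfolding r_def exp_double[symmetric] exp_add[symmetric]
        by (intro arg_cong[of _ _ exp]) (simp add: field_simps)
      hence "kernel 2 (exp (- (\<i> * of_real pi * z)) * r) = exp (- (\<i> * of_real pi * z)) * r / g z"
        by (simp add: kernel_def g_def)
      thus ?thesis
        unfolding cd_sec_def r_def[symmetric] rec[of "exp (- (\<i> * of_real pi * z))"]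
        by (simp add: p_def h_def algebra_simps)
    qed
    have "exp (\<i> * of_real pi * a) = exp (\<i> * of_real pi / 2) * r"
      unfolding r_def exp_add[symmetric]
      by (intro arg_cong[of _ _ exp]) (simp add: a_def field_simps)
    also have "exp (\<i> * of_real pi / 2) = \<i>"
      using cis_pi_half unfolding cis_conv_exp by simp
    finally have ea: "exp (\<i> * of_real pi * a) = \<i> * r" .
    have "h analytic_on {a}"
      unfolding h_def using r ea by (intro analytic_intros analytic_lambert_compose_disc)
        (auto simp: exp_minus norm_mult norm_divide power2_eq_square inverse_eq_divide)
    hence "isCont h a"
      by (rule analytic_at_imp_isCont)
    hence "((\<lambda>z. (z - a) * cd_sec \<tau> z) \<longlongrightarrow>
        (exp (- (\<i> * of_real pi * a)) * r * (1 / (2 * \<i> * of_real pi)) + (a - a) * h a) / 2) (at a)"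
      unfolding split isCont_def by (intro tendsto_intros lim) auto
    also have "exp (- (\<i> * of_real pi * a)) * r = -\<i>"
      using r by (simp add: exp_minus ea)
    finally show "((\<lambda>z. (z - (1 + \<tau>) / 2) * cd_sec \<tau> z) \<longlongrightarrow> - 1 / (4 * of_real pi)) (at ((1 + \<tau>) / 2))"
      by (simp add: a_def)
  }
qed

text \<open>The real part is \<open>pi\<close> times the imaginary part of
  \<open>- 1 / \<tau>\<close>, which again lies in the upper half plane. So the dual nome
  \<open>exp (- (\<i> * pi / \<tau>))\<close> has norm less than 1.\<close>

lemma Re_i_pi_divide_pos:
  assumes "Im \<tau> > 0"
  shows "Re (\<i> * of_real pi / \<tau>) > 0"
proof -
  have "Re (\<i> * of_real pi / \<tau>) = pi * Im \<tau> / (cmod \<tau>)\<^sup>2"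
    by (simp add: Re_divide cmod_power2)
  thus ?thesis using assms by (auto intro!: divide_pos_pos)
qed

lemma cd_tan_cd_like:
  assumes \<tau>: "Im \<tau> > 0"
  shows "cd_like \<tau> (\<lambda>z. if z \<in> cd_poles \<tau> then 0 else cd_tan \<tau> z)"
proof (rule cd_likeI[OF \<tau>])
  define Q where "Q = exp (- (\<i> * of_real pi / \<tau>))"
  have \<tau>0: "\<tau> \<noteq> 0" using \<tau> by auto
  have Q: "norm Q < 1" "Q \<noteq> 0" using Re_i_pi_divide_pos[OF \<tau>] by (simp_all add: Q_def)
  have pw: "(exp (2 * \<i> * of_real pi * z / \<tau>) * Q ^ (2 * k + 1)) ^ 1 =
              exp (2 * \<i> * of_real pi * ((z - 1 / 2 - of_int (int k)) / \<tau>))" for z k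
    unfolding Q_def exp_of_nat_mult[symmetric] exp_add[symmetric] power_one_right using \<tau>0
    by (intro arg_cong[of _ _ exp]) (simp add: field_simps)
  have nz: "1 + (exp (2 * \<i> * of_real pi * z / \<tau>) * Q ^ (2 * k + 1)) ^ 1 \<noteq> 0"
    if "z \<notin> cd_poles \<tau>" for z k
    using that in_cd_polesI'[OF \<tau>0, of z "int k"] unfolding pw by blast
  have nz': "1 + (exp (- (2 * \<i> * of_real pi * z / \<tau>)) * Q ^ (2 * k + 1)) ^ 1 \<noteq> 0"
    if "z \<notin> cd_poles \<tau>" for z k
    using nz[of "- z" k] that cd_poles_minus by fastforce
  have rec: "lambert 1 (-1) Q v = kernel 1 (v * Q) - lambert 1 (-1) Q (v * Q\<^sup>2)" for v
    using lambert_rec[of Q "-1" 1 v] Q by simp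
  {
    fix z assume z: "z \<notin> cd_poles \<tau>"
    show "cd_tan \<tau> analytic_on {z}"
      unfolding cd_tan_def Q_def[symmetric] using Q \<tau>0 nz[OF z] nz'[OF z]
      by (intro analytic_intros analytic_lambert_compose) auto
  next
    fix z
    have "exp (2 * \<i> * of_real pi) = 1"
      using exp_two_pi_i by (simp only: mult_ac)
    hence "exp (2 * \<i> * of_real pi * (z + \<tau>) / \<tau>) = exp (2 * \<i> * of_real pi * z / \<tau>)"
      using \<tau>0 by (simp add: add_divide_distrib distrib_left exp_add)
    moreover from this have "exp (- (2 * \<i> * of_real pi * (z + \<tau>) / \<tau>)) =
        exp (- (2 * \<i> * of_real pi * z / \<tau>))" by (simp only: exp_minus)
    ultimately show "cd_tan \<tau> (z + \<tau>) = cd_tan \<tau> z"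
      by (simp only: cd_tan_def)
  next
    fix z assume z: "z \<notin> cd_poles \<tau>"
    define v where "v = exp (2 * \<i> * of_real pi * z / \<tau>)"
    have v: "v \<noteq> 0" by (simp add: v_def)
    have v': "exp (- (2 * \<i> * of_real pi * z / \<tau>)) = inverse v" by (simp add: v_def exp_minus)
    have "exp (- (2 * \<i> * of_real pi * (z + 1) / \<tau>)) = inverse v * Q\<^sup>2"
      unfolding v'[symmetric] Q_def exp_double[symmetric] exp_add[symmetric] using \<tau>0
      by (intro arg_cong[of _ _ exp]) (simp add: field_simps)
    moreover from this have "exp (2 * \<i> * of_real pi * (z + 1) / \<tau>) = v * inverse (Q\<^sup>2)"
      using exp_minus[of "- (2 * \<i> * of_real pi * (z + 1) / \<tau>)"] by simp
    ultimately have "cd_tan \<tau> (z + 1) = \<i> / (4 * \<tau>) *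
        (1 - 2 * (lambert 1 (-1) Q (v * inverse (Q\<^sup>2)) + lambert 1 (-1) Q (inverse v * Q\<^sup>2)))"
      by (simp only: cd_tan_def Q_def[symmetric])
    also have "lambert 1 (-1) Q (v * inverse (Q\<^sup>2)) = kernel 1 (v * inverse Q) - lambert 1 (-1) Q v"
      using rec[of "v * inverse (Q\<^sup>2)"] Q v by (simp add: field_simps power2_eq_square)
    also have "lambert 1 (-1) Q (inverse v * Q\<^sup>2) =
                 kernel 1 (inverse (v * inverse Q)) - lambert 1 (-1) Q (inverse v)"
      using rec[of "inverse v"] Q v by (simp add: field_simps)
    \<comment> \<open>The two kernels at inverse points add up to 1, so the bracket
      \<open>1 - 2 * L\<close> of \<open>cd_tan\<close> becomes \<open>1 - 2 * (1 - L)\<close>, its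
      negative.\<close>
    also have "kernel 1 (v * inverse Q) - lambert 1 (-1) Q v +
        (kernel 1 (inverse (v * inverse Q)) - lambert 1 (-1) Q (inverse v)) =
        1 - (lambert 1 (-1) Q v + lambert 1 (-1) Q (inverse v))"
    proof -
      have "1 + inverse v * Q \<noteq> 0" using nz'[OF z, of 0] by (simp add: v')
      hence "1 + v * inverse Q \<noteq> 0" using v Q by (simp add: field_simps)
      with kernel_1_inverse[of "v * inverse Q"] v Q show ?thesis by (simp add: algebra_simps)
    qed
    finally show "cd_tan \<tau> (z + 1) = - cd_tan \<tau> z"
      unfolding cd_tan_def Q_def[symmetric] v_def[symmetric] v' by (simp add: algebra_simps)
  next
    define a where "a = (1 + \<tau>) / 2"
    \<comment> \<open>Here the singular term is \<open>k = 0\<close> of the first sum, where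
      \<open>exp (2 * \<i> * pi * z / \<tau>) * Q\<close> tends to -1.\<close>
    define g where "g = (\<lambda>z. 1 + exp (2 * \<i> * of_real pi / \<tau> * z + - (\<i> * of_real pi / \<tau>)))"
    have g: "g z = 1 + exp (2 * \<i> * of_real pi * z / \<tau>) * Q" for z
      unfolding g_def Q_def exp_add[symmetric] by simp
    have "2 * \<i> * of_real pi / \<tau> * a + - (\<i> * of_real pi / \<tau>) = \<i> * of_real pi"
      using \<tau>0 by (simp add: a_def field_simps)
    hence *: "exp (2 * \<i> * of_real pi / \<tau> * a + - (\<i> * of_real pi / \<tau>)) = -1"
      by (simp only: exp_pi_i')
    hence "1 + exp (2 * \<i> * of_real pi * a / \<tau>) * Q = 0"
      using g[of a] unfolding g_def by simp
    hence ea: "exp (2 * \<i> * of_real pi * a / \<tau>) * Q = -1"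
      by (simp add: add_eq_0_iff)
    define p where "p = (\<lambda>z. (z - a) / g z)"
    have lim: "(p \<longlongrightarrow> - 1 / (2 * \<i> * of_real pi / \<tau>)) (at a)"
      unfolding p_def g_def using \<tau>0 by (intro tendsto_divide_one_plus_exp *) auto
    define h where "h = (\<lambda>z. 1 - 2 * (lambert 1 (-1) Q (exp (- (2 * \<i> * of_real pi * z / \<tau>))) -
                      lambert 1 (-1) Q (exp (2 * \<i> * of_real pi * z / \<tau>) * Q\<^sup>2)))"
    have split: "(z - a) * cd_tan \<tau> z = \<i> / (4 * \<tau>) *
        ((z - a) * h z - 2 * (exp (2 * \<i> * of_real pi * z / \<tau>) * Q * p z))" for z
    proof -
      have "b * (c * (1 - 2 * (w / d - A + B))) = c * (b * (1 - 2 * (B - A)) - 2 * (w * (b / d)))"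
        for b c d w A B :: complex by (simp add: divide_inverse algebra_simps)
      thus ?thesis
        unfolding cd_tan_def Q_def[symmetric] rec[of "exp (2 * \<i> * of_real pi * z / \<tau>)"]
          h_def p_def g kernel_def power_one_right .
    qed
    have e1: "exp (2 * \<i> * of_real pi * a / \<tau>) = - inverse Q"
      using ea Q by (simp add: field_simps)
    have e2: "exp (- (2 * \<i> * of_real pi * a / \<tau>)) = - Q"
      by (simp add: exp_minus e1)
    have "h analytic_on {a}"
      unfolding h_def using Q e1 e2 \<tau>0 by (intro analytic_intros analytic_lambert_compose_disc)
        (simp_all add: norm_mult norm_divide power2_eq_square inverse_eq_divide)
    hence "isCont h a" by (rule analytic_at_imp_isCont)
    hence "((\<lambda>z. (z - a) * cd_tan \<tau> z) \<longlongrightarrow> \<i> / (4 * \<tau>) * ((a - a) * h a -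
        2 * (exp (2 * \<i> * of_real pi * a / \<tau>) * Q * (- 1 / (2 * \<i> * of_real pi / \<tau>))))) (at a)"
      unfolding split isCont_def using \<tau>0 by (intro tendsto_intros lim) auto
    also have "\<i> / (4 * \<tau>) * ((a - a) * h a -
        2 * (exp (2 * \<i> * of_real pi * a / \<tau>) * Q * (- 1 / (2 * \<i> * of_real pi / \<tau>)))) =
        - 1 / (4 * of_real pi)"
      unfolding ea using \<tau>0 by (simp add: field_simps)
    finally show "((\<lambda>z. (z - (1 + \<tau>) / 2) * cd_tan \<tau> z) \<longlongrightarrow> - 1 / (4 * of_real pi)) (at ((1 + \<tau>) / 2))"
      by (simp add: a_def)
  }
qed

lemma cd_sec_sums:
  assumes \<tau>: "Im \<tau> > 0" and z: "z = of_real x + of_real y * \<tau>" and y: "\<bar>y\<bar> < 1 / 2"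
  shows "(\<lambda>n. \<i> / 2 * ((-1) ^ n * cos ((2 * of_nat n + 1) * of_real pi * z)
            / sin ((of_nat n + 1/2) * of_real pi * \<tau>))) sums cd_sec \<tau> z"
proof -
  define r where "r = exp (\<i> * of_real pi * \<tau> / 2)"
  define u where "u = exp (\<i> * of_real pi * z)"
  have u0: "u \<noteq> 0" by (simp add: u_def)
  have r: "norm r < 1" "r \<noteq> 0" using \<tau> by (simp_all add: r_def)
  have y': "- y * Im \<tau> < Im \<tau> / 2" "y * Im \<tau> < Im \<tau> / 2"
    using y \<tau> mult_strict_right_mono[of "-y" "1/2" "Im \<tau>"] mult_strict_right_mono[of "y" "1/2" "Im \<tau>"]
    by auto
  have "norm (u * r) = exp (pi * (- y * Im \<tau> - Im \<tau> / 2))"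
    by (simp add: u_def r_def norm_mult exp_add[symmetric] z algebra_simps)
  also have "\<dots> < 1" using y' by (simp add: mult_less_0_iff)
  finally have ur: "norm (u * r) < 1" .
  have "norm (inverse u * r) = exp (pi * (y * Im \<tau> - Im \<tau> / 2))"
    by (simp add: u_def r_def norm_mult exp_minus[symmetric] exp_add[symmetric] z algebra_simps)
  also have "\<dots> < 1" using y' by (simp add: mult_less_0_iff)
  finally have ur': "norm (inverse u * r) < 1" .
  have "(\<lambda>n. ((-1) ^ n * (u * r) ^ (2 * n + 1) / (1 - 1 * r ^ (2 * (2 * n + 1))) +
              (-1) ^ n * (inverse u * r) ^ (2 * n + 1) / (1 - 1 * r ^ (2 * (2 * n + 1)))) / 2)
          sums ((lambert 2 1 r u + lambert 2 1 r (inverse u)) / 2)"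
    using r ur ur' by (intro sums_divide sums_add lambert_sums) auto
  moreover have "((-1) ^ n * (u * r) ^ (2 * n + 1) / (1 - 1 * r ^ (2 * (2 * n + 1))) +
              (-1) ^ n * (inverse u * r) ^ (2 * n + 1) / (1 - 1 * r ^ (2 * (2 * n + 1)))) / 2 =
      \<i> / 2 * ((-1) ^ n * cos ((2 * of_nat n + 1) * of_real pi * z)
            / sin ((of_nat n + 1/2) * of_real pi * \<tau>))" for n
  proof -
    define j where "j = 2 * n + 1"
    \<comment> \<open>The cosine is \<open>(W + 1 / W) / 2\<close> and the sine
      \<open>(R - 1 / R) / (2 * \<i>)\<close>, so the terms are compared as rational functions of
      \<open>W\<close> and \<open>R\<close>.\<close>
    define W R where "W = u ^ j" and "R = r ^ j"
    have WR: "W \<noteq> 0" "R \<noteq> 0" using u0 r by (auto simp: W_def R_def)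
    have R2: "R\<^sup>2 \<noteq> 1"
    proof
      assume "R\<^sup>2 = 1"
      hence "norm r ^ (2 * j) = 1"
        by (metis R_def norm_one norm_power power_mult mult.commute)
      moreover have "norm r ^ (2 * j) < 1"
        using r by (intro power_less_one_iff[THEN iffD2]) (auto simp: j_def)
      ultimately show False by simp
    qed
    have "exp (\<i> * ((2 * of_nat n + 1) * of_real pi * z)) = W"
      unfolding W_def u_def exp_of_nat_mult[symmetric]
      by (intro arg_cong[of _ _ exp]) (simp add: j_def algebra_simps)
    hence cos: "cos ((2 * of_nat n + 1) * of_real pi * z) = (W + inverse W) / 2"
      by (simp add: cos_exp_eq exp_minus)
    have "exp (\<i> * ((of_nat n + 1/2) * of_real pi * \<tau>)) = R"
      unfolding R_def r_def exp_of_nat_mult[symmetric]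
      by (intro arg_cong[of _ _ exp]) (simp add: j_def field_simps)
    hence sin: "sin ((of_nat n + 1/2) * of_real pi * \<tau>) = (R - inverse R) / (2 * \<i>)"
      by (simp add: sin_exp_eq exp_minus)
    have a: "(u * r) ^ j = W * R" "(inverse u * r) ^ j = inverse W * R" "r ^ (2 * j) = R\<^sup>2"
      by (simp_all only: W_def R_def power_mult_distrib power_inverse power_mult[symmetric] mult.commute)
    have "(W * R / (1 - R\<^sup>2) + inverse W * R / (1 - R\<^sup>2)) / 2 =
        \<i> / 2 * (((W + inverse W) / 2) / ((R - inverse R) / (2 * \<i>)))"
    proof -
      have "R - inverse R = - (1 - R\<^sup>2) / R" using WR by (simp add: field_simps power2_eq_square)
      moreover have "1 - R\<^sup>2 \<noteq> 0" using R2 by simp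
      ultimately show ?thesis using WR by (simp add: divide_simps) (simp add: algebra_simps)
    qed
    from arg_cong[OF this, of "\<lambda>t. (-1) ^ n * t"] show ?thesis
      unfolding j_def[symmetric] a cos sin by (simp add: algebra_simps add_divide_distrib)
  qed
  ultimately show ?thesis
    by (simp only: cd_sec_def r_def[symmetric] u_def[symmetric] exp_minus)
qed

lemma cd_tan_sums:
  assumes \<tau>: "Im \<tau> > 0" and z: "z = of_real x + of_real y * \<tau>" and x: "\<bar>x\<bar> < 1 / 2"
  shows "(\<lambda>n. \<i> / (2 * \<tau>) * ((-1) ^ Suc n * cos (2 * of_nat (Suc n) * of_real pi * z / \<tau>)
            / cos (of_nat (Suc n) * of_real pi / \<tau>))) sums (cd_tan \<tau> z - \<i> / (4 * \<tau>))"
proof -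
  define Q where "Q = exp (- (\<i> * of_real pi / \<tau>))"
  define v where "v = exp (2 * \<i> * of_real pi * z / \<tau>)"
  define c where "c = Re (\<i> * of_real pi / \<tau>)"
  have \<tau>0: "\<tau> \<noteq> 0" using \<tau> by auto
  have c: "c > 0" unfolding c_def by (rule Re_i_pi_divide_pos[OF \<tau>])
  have v0: "v \<noteq> 0" by (simp add: v_def)
  have v': "exp (- (2 * \<i> * of_real pi * z / \<tau>)) = inverse v" by (simp add: v_def exp_minus)
  have Q: "norm Q < 1" "Q \<noteq> 0" using c by (simp_all add: Q_def c_def)
  have x': "2 * x * c < c" "- (2 * x * c) < c"
    using x c mult_strict_right_mono[of "2 * x" 1 c] mult_strict_right_mono[of "- 2 * x" 1 c] by auto
  \<comment> \<open>Division by \<open>\<tau>\<close> makes the contribution of \<open>y\<close>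
    purely imaginary, so the norm of \<open>v\<close> depends on \<open>x\<close> alone.\<close>
  have "2 * \<i> * of_real pi * z / \<tau> = of_real (2 * x) * (\<i> * of_real pi / \<tau>) + \<i> * of_real (2 * pi * y)"
    using \<tau>0 by (simp add: z field_simps)
  moreover have "Re (of_real s * w + \<i> * of_real t) = s * Re w" for s t w by simp
  ultimately have Re_v: "Re (2 * \<i> * of_real pi * z / \<tau>) = 2 * x * c"
    unfolding c_def by (simp only:)
  have nv: "norm v = exp (2 * x * c)" and nQ: "norm Q = exp (- c)"
    unfolding v_def Q_def norm_exp_eq_Re Re_v by (simp_all add: c_def)
  have vQ: "norm (v * Q) < 1"
    unfolding norm_mult nv nQ exp_add[symmetric] using x' by simp
  have vQ': "norm (inverse v * Q) < 1"
    unfolding norm_mult norm_inverse nv nQ exp_minus[symmetric] exp_add[symmetric] using x' by simp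
  have "(\<lambda>n. - (\<i> / (2 * \<tau>)) *
              ((-1) ^ n * (v * Q) ^ (1 * n + 1) / (1 - (-1) * Q ^ (2 * (1 * n + 1))) +
              (-1) ^ n * (inverse v * Q) ^ (1 * n + 1) / (1 - (-1) * Q ^ (2 * (1 * n + 1)))))
          sums (- (\<i> / (2 * \<tau>)) * (lambert 1 (-1) Q v + lambert 1 (-1) Q (inverse v)))"
    using Q vQ vQ' by (intro sums_mult sums_add lambert_sums) auto
  moreover have "- (\<i> / (2 * \<tau>)) *
              ((-1) ^ n * (v * Q) ^ (1 * n + 1) / (1 - (-1) * Q ^ (2 * (1 * n + 1))) +
              (-1) ^ n * (inverse v * Q) ^ (1 * n + 1) / (1 - (-1) * Q ^ (2 * (1 * n + 1)))) =
      \<i> / (2 * \<tau>) * ((-1) ^ Suc n * cos (2 * of_nat (Suc n) * of_real pi * z / \<tau>)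
            / cos (of_nat (Suc n) * of_real pi / \<tau>))" for n
  proof -
    define j where "j = Suc n"
    define W R where "W = v ^ j" and "R = Q ^ j"
    have WR: "W \<noteq> 0" "R \<noteq> 0" using v0 Q by (auto simp: W_def R_def)
    have "norm R < 1" using Q by (simp add: R_def norm_power j_def power_less_one_iff del: power_Suc)
    hence R2: "1 + R\<^sup>2 \<noteq> 0" by (rule one_plus_power_nonzero) simp
    have "exp (\<i> * (2 * of_nat j * of_real pi * z / \<tau>)) = W"
      unfolding W_def v_def exp_of_nat_mult[symmetric]
      by (intro arg_cong[of _ _ exp]) (simp add: algebra_simps)
    hence cos1: "cos (2 * of_nat j * of_real pi * z / \<tau>) = (W + inverse W) / 2"
      by (simp add: cos_exp_eq exp_minus)
    have "exp (- (\<i> * (of_nat j * of_real pi / \<tau>))) = R"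
      unfolding R_def Q_def exp_of_nat_mult[symmetric]
      by (intro arg_cong[of _ _ exp]) (simp add: algebra_simps)
    moreover from this have "exp (\<i> * (of_nat j * of_real pi / \<tau>)) = inverse R"
      by (metis exp_minus minus_minus)
    ultimately have cos2: "cos (of_nat j * of_real pi / \<tau>) = (inverse R + R) / 2"
      by (simp add: cos_exp_eq)
    have a: "(v * Q) ^ j = W * R" "(inverse v * Q) ^ j = inverse W * R" "Q ^ (2 * j) = R\<^sup>2"
      by (simp_all only: W_def R_def power_mult_distrib power_inverse power_mult[symmetric] mult.commute)
    have *: "W * R / (1 + R\<^sup>2) + inverse W * R / (1 + R\<^sup>2) = ((W + inverse W) / 2) / ((inverse R + R) / 2)"
    proof -
      have "inverse R + R = (1 + R\<^sup>2) / R" using WR by (simp add: field_simps power2_eq_square)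
      thus ?thesis using WR R2 by (simp add: divide_simps) (simp add: algebra_simps)
    qed
    have 1: "s * b / d + s * c / d = s * (b / d + c / d)" for s b c d :: complex
      by (simp add: distrib_left)
    \<comment> \<open>The coefficient carries \<open>(-1) ^ Suc n\<close>, the Lambert series
      \<open>(-1) ^ n\<close>; the minus sign in front of \<open>\<i> / (2 * \<tau>)\<close>
      accounts for the difference.\<close>
    have 2: "b * ((-1) ^ j * c / d) = - b * ((-1) ^ n * (c / d))" for b c d :: complex
      by (simp add: j_def)
    show ?thesis
      unfolding mult_1 Suc_eq_plus1[symmetric] j_def[symmetric] a cos1 cos2 1 2
        mult_minus1 diff_minus_eq_add * ..
  qed
  ultimately have "(\<lambda>n. \<i> / (2 * \<tau>) * ((-1) ^ Suc n * cos (2 * of_nat (Suc n) * of_real pi * z / \<tau>)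
            / cos (of_nat (Suc n) * of_real pi / \<tau>))) sums
      (- (\<i> / (2 * \<tau>)) * (lambert 1 (-1) Q v + lambert 1 (-1) Q (inverse v)))"
    by (simp only:)
  also have "- (\<i> / (2 * \<tau>)) * (lambert 1 (-1) Q v + lambert 1 (-1) Q (inverse v)) =
      cd_tan \<tau> z - \<i> / (4 * \<tau>)"
    unfolding cd_tan_def Q_def[symmetric] v' v_def[symmetric] using \<tau>0 by (simp add: field_simps)
  finally show ?thesis .
qed

subsection \<open>The product formula\<close>

text \<open>The infinite products are broken up into values of \<open>qprod\<close>, each entire in
  \<open>z\<close>, so that shifts and zeros can be followed factor by factor.\<close>

definition cd_prod :: "complex \<Rightarrow> complex \<Rightarrow> complex" where
  "cd_prod \<tau> z = (let q = qpow \<tau> 1; p = qpow \<tau> (1/2);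
       U = exp (2 * \<i> * of_real pi * z); V = exp (- 2 * \<i> * of_real pi * z)
     in cos (of_real pi * z) * qpow \<tau> (1/4) * ((qprod q (- q))\<^sup>2 / (qprod q (- p))\<^sup>2) *
          (qprod q (U * q) * qprod q (V * q) / (qprod q (U * p) * qprod q (V * p))))"

lemma qpow_add: "qpow \<tau> (s + t) = qpow \<tau> s * qpow \<tau> t"
  by (simp add: qpow_def distrib_left exp_add)

lemma qpow_of_nat: "qpow \<tau> (real n) = qpow \<tau> 1 ^ n"
  by (simp add: qpow_def exp_of_nat_mult[symmetric] mult_ac)

lemma norm_qpow_less_one: "Im \<tau> > 0 \<Longrightarrow> s > 0 \<Longrightarrow> norm (qpow \<tau> s) < 1"
  by (simp add: qpow_def)

lemma qpow_nonzero: "qpow \<tau> s \<noteq> 0"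
  by (simp add: qpow_def)

lemma qprod_minus_nonzero:
  assumes "norm q < 1" "norm v < 1"
  shows "qprod q (- v) \<noteq> 0"
proof -
  have "1 + - v * q ^ n \<noteq> 0" for n
  proof
    assume "1 + - v * q ^ n = 0"
    hence "norm (v * q ^ n) = 1" by simp
    moreover have "norm v * norm q ^ n \<le> norm v"
      using assms by (intro mult_left_le power_le_one) auto
    ultimately show False using assms by (simp add: norm_mult norm_power)
  qed
  thus ?thesis using assms by (simp add: qprod_eq_0_iff)
qed

lemma analytic_qprod_compose:
  assumes "norm q < 1" "f analytic_on {z}"
  shows "(\<lambda>z. qprod q (f z)) analytic_on {z}"
proof -
  have "qprod q analytic_on UNIV"
    using holomorphic_qprod[OF assms(1)] by (simp add: analytic_on_open)
  hence "qprod q analytic_on f ` {z}" by (rule analytic_on_subset) auto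
  with analytic_on_compose[OF assms(2)] show ?thesis by (simp add: o_def)
qed

lemma qprod_nonzero_off_poles:
  assumes "Im \<tau> > 0" "z \<notin> cd_poles \<tau>"
  shows "qprod (qpow \<tau> 1) (exp (2 * \<i> * of_real pi * z) * qpow \<tau> (1/2)) \<noteq> 0"
proof -
  have "exp (2 * \<i> * of_real pi * z) * qpow \<tau> (1/2) * qpow \<tau> 1 ^ n =
          exp (2 * \<i> * of_real pi * (z + \<tau> / 2 + of_int (int n) * \<tau>))" for n
    unfolding qpow_def exp_of_nat_mult[symmetric] exp_add[symmetric]
    by (intro arg_cong[of _ _ exp]) (simp add: field_simps)
  hence "1 + exp (2 * \<i> * of_real pi * z) * qpow \<tau> (1/2) * qpow \<tau> 1 ^ n \<noteq> 0" for n
    using in_cd_polesI[of z \<tau> "int n"] assms(2) by metis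
  thus ?thesis
    using norm_qpow_less_one[OF assms(1), of 1] by (simp add: qprod_eq_0_iff)
qed

lemma cd_prod_cd_like:
  assumes \<tau>: "Im \<tau> > 0"
  shows "cd_like \<tau> (\<lambda>z. if z \<in> cd_poles \<tau> then 0 else cd_prod \<tau> z)"
proof (rule cd_likeI[OF \<tau>])
  define q p r where "q = qpow \<tau> 1" and "p = qpow \<tau> (1/2)" and "r = qpow \<tau> (1/4)"
  define U where "U = (\<lambda>z :: complex. exp (2 * \<i> * of_real pi * z))"
  define V where "V = (\<lambda>z :: complex. exp (- 2 * \<i> * of_real pi * z))"
  define K where "K = (qprod q (- q))\<^sup>2 / (qprod q (- p))\<^sup>2"
  define N where "N = (\<lambda>z. cos (of_real pi * z) * qprod q (U z * q) * qprod q (V z * q))"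
  define D where "D = (\<lambda>z. qprod q (U z * p) * qprod q (V z * p))"
  have q: "norm q < 1" "q \<noteq> 0" and p: "norm p < 1" "p \<noteq> 0" and r: "r \<noteq> 0"
    using \<tau> by (simp_all add: q_def p_def r_def norm_qpow_less_one qpow_nonzero)
  have qp: "q = p\<^sup>2" and pr: "p = r\<^sup>2"
    by (simp_all add: q_def p_def r_def power2_eq_square qpow_add[symmetric])
  have UV: "U z * V z = 1" "U z \<noteq> 0" "V z \<noteq> 0" for z
    by (simp_all add: U_def V_def flip: exp_add)
  have cd_prod: "cd_prod \<tau> z = r * K * (N z / D z)" for z
    by (simp add: cd_prod_def Let_def q_def p_def r_def U_def V_def K_def N_def D_def mult_ac)
  have D_nz: "qprod q (U z * p) \<noteq> 0" "qprod q (V z * p) \<noteq> 0" if "z \<notin> cd_poles \<tau>" for z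
    using qprod_nonzero_off_poles[OF \<tau>, of z] qprod_nonzero_off_poles[OF \<tau>, of "- z"]
      that cd_poles_minus[of z \<tau>] by (auto simp: q_def p_def U_def V_def)
  have U_ana: "U analytic_on {z}" and V_ana: "V analytic_on {z}" for z
    unfolding U_def V_def by (intro analytic_intros)+
  have N_ana: "N analytic_on {z}" for z
    unfolding N_def using q by (intro analytic_intros analytic_qprod_compose U_ana V_ana)
  have D_ana: "D analytic_on {z}" for z
    unfolding D_def using q by (intro analytic_intros analytic_qprod_compose U_ana V_ana)
  \<comment> \<open>The cosine supplies the missing factor \<open>1 + U z\<close> or, equally,
    \<open>1 + V z\<close>, up to an exponential. After the shift by \<open>\<tau>\<close>, the
    products in \<open>N1\<close> are those of \<open>N2\<close> before the shift.\<close>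
  have N1: "N z = exp (- (\<i> * of_real pi * z)) / 2 * qprod q (U z) * qprod q (V z * q)"
    and N2: "N z = exp (\<i> * of_real pi * z) / 2 * qprod q (V z) * qprod q (U z * q)" for z
  proof -
    define u where "u = exp (\<i> * of_real pi * z)"
    have u: "u \<noteq> 0" by (simp add: u_def)
    have u': "exp (- (\<i> * of_real pi * z)) = inverse u" by (simp add: u_def exp_minus)
    have Uu: "U z = u\<^sup>2" unfolding U_def u_def exp_double[symmetric] by (simp add: mult_ac)
    have Vu: "V z = inverse (u\<^sup>2)" using UV[of z] unfolding Uu by (metis inverse_unique)
    have cos: "cos (of_real pi * z) = (u + inverse u) / 2"
      by (simp add: cos_exp_eq u_def exp_minus mult_ac)
    have "cos (of_real pi * z) = inverse u / 2 * (1 + U z)"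
      unfolding cos Uu using u by (simp add: field_simps power2_eq_square)
    thus "N z = exp (- (\<i> * of_real pi * z)) / 2 * qprod q (U z) * qprod q (V z * q)"
      unfolding N_def u' using qprod_rec[OF q(1), of "U z"] by simp
    have "cos (of_real pi * z) = u / 2 * (1 + V z)"
      unfolding cos Vu using u by (simp add: field_simps power2_eq_square)
    thus "N z = exp (\<i> * of_real pi * z) / 2 * qprod q (V z) * qprod q (U z * q)"
      unfolding N_def u_def[symmetric] using qprod_rec[OF q(1), of "V z"] by simp
  qed
  have U_shift: "U (z + \<tau>) = U z * q" and V_shift: "V (z + \<tau>) = V z / q" for z
    unfolding U_def V_def q_def qpow_def exp_add[symmetric] exp_diff[symmetric]
    by (rule arg_cong[of _ _ exp], simp add: algebra_simps)+
  {
    fix z assume z: "z \<notin> cd_poles \<tau>"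
    show "cd_prod \<tau> analytic_on {z}"
      unfolding cd_prod using D_nz[OF z]
      by (intro analytic_intros N_ana D_ana) (auto simp: D_def)
  next
    fix z
    have "U (z + 1) = U z"
      using exp_two_pi_i by (simp add: U_def distrib_left exp_add mult_ac)
    moreover from this have "V (z + 1) = V z" using UV[of z] UV[of "z + 1"]
      by (metis mult_cancel_left)
    moreover have "cos (of_real pi * (z + 1)) = - cos (of_real pi * z)"
      by (simp add: distrib_left cos_add)
    ultimately show "cd_prod \<tau> (z + 1) = - cd_prod \<tau> z"
      by (simp add: cd_prod N_def D_def)
  next
    fix z
    have e: "exp (- (\<i> * of_real pi * (z + \<tau>))) = exp (\<i> * of_real pi * z) * (V z / p)"
      unfolding V_def p_def qpow_def exp_diff[symmetric] exp_add[symmetric]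
      by (intro arg_cong[of _ _ exp]) (simp add: field_simps)
    have N: "N (z + \<tau>) = V z / p * N z"
      unfolding N1[of "z + \<tau>"] N2[of z] e U_shift V_shift using q by simp
    \<comment> \<open>Under the shift one factor in \<open>V\<close> appears and one in
      \<open>U\<close> disappears; their quotient is \<open>V z / p\<close>, the multiplier already
      found for \<open>N\<close>.\<close>
    have "1 + V z / p = V z / p * (1 + U z * p)"
      using UV[of z] p by (simp add: field_simps)
    moreover have "qprod q (V z / p) = (1 + V z / p) * qprod q (V z * p)"
      using qprod_rec[OF q(1), of "V z / p"] p by (simp add: qp power2_eq_square)
    moreover have "V z / q * p = V z / p" using p by (simp add: qp power2_eq_square)
    moreover have "qprod q (U z * p) = (1 + U z * p) * qprod q (U z * q * p)"
      using qprod_rec[OF q(1), of "U z * p"] by (simp add: mult_ac)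
    ultimately have D: "D (z + \<tau>) = V z / p * D z"
      unfolding D_def U_shift V_shift by simp
    show "cd_prod \<tau> (z + \<tau>) = cd_prod \<tau> z"
      unfolding cd_prod N D using UV[of z] p by simp
  next
    define a where "a = (1 + \<tau>) / 2"
    define g where "g = (\<lambda>z. 1 + exp (- (2 * \<i> * of_real pi) * z + \<i> * of_real pi * \<tau>))"
    define s where "s = (\<lambda>z. (z - a) / g z)"
    have g: "g z = 1 + V z * p" for z
      unfolding g_def V_def p_def qpow_def exp_add[symmetric] by (simp add: mult_ac)
    have "- (2 * \<i> * of_real pi) * a + \<i> * of_real pi * \<tau> = - (\<i> * of_real pi)"
      by (simp add: a_def field_simps)
    hence *: "exp (- (2 * \<i> * of_real pi) * a + \<i> * of_real pi * \<tau>) = -1"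
      by (simp only: exp_minus) simp
    have lim: "(s \<longlongrightarrow> 1 / (2 * \<i> * of_real pi)) (at a)"
      using tendsto_divide_one_plus_exp[OF *] by (simp add: s_def g_def)
    have "1 + V a * p = 0" unfolding g[symmetric] g_def * by simp
    hence Va: "V a = - inverse p" using p by (simp add: field_simps add_eq_0_iff)
    have "- U a = p" using UV[of a] p unfolding Va by (simp add: field_simps)
    hence Ua: "U a = - p" by (metis minus_minus)
    have ea: "exp (- (\<i> * of_real pi * a)) = - \<i> * inverse r"
    proof -
      have "exp (- (\<i> * of_real pi * a)) = exp (- (\<i> * of_real pi / 2)) * inverse r"
        unfolding r_def qpow_def exp_minus[symmetric] exp_add[symmetric]
        by (intro arg_cong[of _ _ exp]) (simp add: a_def field_simps)
      also have "exp (- (\<i> * of_real pi / 2)) = - \<i>"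
        using cis_pi_half unfolding cis_conv_exp by (simp add: exp_minus)
      finally show ?thesis .
    qed
    \<comment> \<open>The factor \<open>1 + V z * p\<close>, which vanishes at \<open>a\<close>, is
      moved into \<open>s\<close>; all \<open>qprod\<close> values left in the denominator are
      nonzero at \<open>a\<close>.\<close>
    define h where "h = (\<lambda>z. N z / (qprod q (U z * p) * qprod q (V z * p * q)))"
    have split: "(z - a) * cd_prod \<tau> z = r * K * (h z * s z)" for z
      unfolding cd_prod h_def D_def s_def g qprod_rec[OF q(1), of "V z * p"] by (simp add: mult_ac)
    have pqa: "U a * p = - q" "V a * p * q = - q" "V a * q = - p"
      using p by (simp_all add: Ua Va qp power2_eq_square)
    have nz: "qprod q (- q) \<noteq> 0" "qprod q (- p) \<noteq> 0"
      by (rule qprod_minus_nonzero[OF q(1) q(1)], rule qprod_minus_nonzero[OF q(1) p(1)])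
    have "h analytic_on {a}"
      unfolding h_def using nz q
      by (intro analytic_intros N_ana U_ana V_ana analytic_qprod_compose) (auto simp: pqa)
    hence "isCont h a" by (rule analytic_at_imp_isCont)
    hence "((\<lambda>z. (z - a) * cd_prod \<tau> z) \<longlongrightarrow> r * K * (h a * (1 / (2 * \<i> * of_real pi)))) (at a)"
      unfolding split isCont_def by (intro tendsto_intros lim)
    \<comment> \<open>At \<open>a\<close> the numerator contributes
      \<open>(qprod q (- p))\<^sup>2\<close> and the denominator
      \<open>(qprod q (- q))\<^sup>2\<close>, which \<open>K\<close> cancels, while \<open>r\<close>
      cancels the \<open>inverse r\<close> in \<open>ea\<close>. This is the origin of the prefactor
      and of \<open>q^(1/4)\<close>.\<close>
    also have "r * K * (h a * (1 / (2 * \<i> * of_real pi))) = - 1 / (4 * of_real pi)"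
      unfolding h_def N1 pqa ea K_def using nz r by (simp add: Ua field_simps power2_eq_square)
    finally show "((\<lambda>z. (z - (1 + \<tau>) / 2) * cd_prod \<tau> z) \<longlongrightarrow> - 1 / (4 * of_real pi)) (at ((1 + \<tau>) / 2))"
      by (simp add: a_def)
  }
qed

section \<open>Existence and uniqueness of the function defined by the expansions\<close>

text \<open>In the real basis \<open>1\<close>, \<open>\<tau>\<close> both coordinates of a pole are
  half-integers that are not integers, hence at least 1/2 in absolute value.\<close>

lemma strip_not_cd_poles:
  assumes \<tau>: "Im \<tau> > 0" and z: "z = of_real x + of_real y * \<tau>"
    and xy: "\<bar>x\<bar> < 1 / 2 \<or> \<bar>y\<bar> < 1 / 2"
  shows "z \<notin> cd_poles \<tau>"
proof
  assume "z \<in> cd_poles \<tau>"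
  then obtain m n :: int where "z = (1 + \<tau>) / 2 + of_int m + of_int n * \<tau>"
    by (auto simp: cd_poles_def)
  hence *: "of_real x + of_real y * \<tau> = (1 + \<tau>) / 2 + of_int m + of_int n * \<tau>" using z by simp
  from arg_cong[OF *, of Im] have "y * Im \<tau> = (1 / 2 + of_int n) * Im \<tau>"
    by (simp add: algebra_simps)
  hence y: "y = 1 / 2 + of_int n" using \<tau> by (simp only: mult_cancel_right) auto
  from arg_cong[OF *, of Re] have x: "x = 1 / 2 + of_int m"
    unfolding y by (simp add: field_simps)
  have "\<bar>1 / 2 + of_int k :: real\<bar> \<ge> 1 / 2" for k :: int
    by (cases "k \<ge> 0") auto
  with x y xy show False by (metis not_less)
qed

text \<open>On the strip \<open>\<bar>Im z\<bar> < Im \<tau> / 2\<close>, that is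
  \<open>\<bar>y\<bar> < 1/2\<close>, both functions are the sum of the same series.\<close>

lemma is_CD_unique:
  assumes \<tau>: "Im \<tau> > 0" and F: "is_CD \<tau> F" and G: "is_CD \<tau> G"
  shows "F = G"
proof (rule nicely_meromorphic_eqI)
  show "open {z. \<bar>Im z\<bar> < Im \<tau> / 2}"
    by (intro open_Collect_less continuous_intros)
  show "{z. \<bar>Im z\<bar> < Im \<tau> / 2} \<noteq> {}"
    using \<tau> by (auto intro!: exI[of _ 0])
  fix z assume z: "z \<in> {z. \<bar>Im z\<bar> < Im \<tau> / 2}"
  define y where "y = Im z / Im \<tau>"
  define x where "x = Re z - y * Re \<tau>"
  have "z = of_real x + of_real y * \<tau>"
    using \<tau> by (simp add: complex_eq_iff x_def y_def)
  moreover have "\<bar>y\<bar> < 1 / 2" using z \<tau> by (simp add: y_def field_simps)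
  ultimately show "F z = G z"
    using F G unfolding is_CD_def by (meson sums_unique2)
qed (use F G in \<open>simp_all add: is_CD_def\<close>)

lemma has_prod_cd_prefactor:
  assumes \<tau>: "Im \<tau> > 0"
  shows "(\<lambda>n. (1 - qpow \<tau> (real n + 1))\<^sup>2 / (1 - qpow \<tau> (real n + 1/2))\<^sup>2) has_prod
           ((qprod (qpow \<tau> 1) (- qpow \<tau> 1))\<^sup>2 / (qprod (qpow \<tau> 1) (- qpow \<tau> (1/2)))\<^sup>2)"
proof -
  have "norm (qpow \<tau> 1) < 1" using \<tau> by (rule norm_qpow_less_one) simp
  note hp = has_prod_qprod[OF this]
  have "(\<lambda>n. (1 + - qpow \<tau> 1 * qpow \<tau> 1 ^ n)\<^sup>2 / (1 + - qpow \<tau> (1/2) * qpow \<tau> 1 ^ n)\<^sup>2) has_prod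
           ((qprod (qpow \<tau> 1) (- qpow \<tau> 1))\<^sup>2 / (qprod (qpow \<tau> 1) (- qpow \<tau> (1/2)))\<^sup>2)"
    by (intro has_prod_divide has_prod_power hp)
  thus ?thesis by (simp add: qpow_add qpow_of_nat mult_ac)
qed

lemma has_prod_cd_quotient:
  assumes \<tau>: "Im \<tau> > 0"
  shows "(\<lambda>n. ((1 + U * qpow \<tau> (real n + 1)) * (1 + V * qpow \<tau> (real n + 1))) /
              ((1 + U * qpow \<tau> (real n + 1/2)) * (1 + V * qpow \<tau> (real n + 1/2)))) has_prod
           (qprod (qpow \<tau> 1) (U * qpow \<tau> 1) * qprod (qpow \<tau> 1) (V * qpow \<tau> 1) /
            (qprod (qpow \<tau> 1) (U * qpow \<tau> (1/2)) * qprod (qpow \<tau> 1) (V * qpow \<tau> (1/2))))"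
proof -
  have "norm (qpow \<tau> 1) < 1" using \<tau> by (rule norm_qpow_less_one) simp
  note hp = has_prod_qprod[OF this]
  have "(\<lambda>n. ((1 + U * qpow \<tau> 1 * qpow \<tau> 1 ^ n) * (1 + V * qpow \<tau> 1 * qpow \<tau> 1 ^ n)) /
             ((1 + U * qpow \<tau> (1/2) * qpow \<tau> 1 ^ n) * (1 + V * qpow \<tau> (1/2) * qpow \<tau> 1 ^ n))) has_prod
           (qprod (qpow \<tau> 1) (U * qpow \<tau> 1) * qprod (qpow \<tau> 1) (V * qpow \<tau> 1) /
            (qprod (qpow \<tau> 1) (U * qpow \<tau> (1/2)) * qprod (qpow \<tau> 1) (V * qpow \<tau> (1/2))))"
    by (intro has_prod_divide has_prod_mult hp)
  thus ?thesis by (simp add: qpow_add qpow_of_nat mult_ac)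
qed

lemma is_CD_cd_prod:
  assumes \<tau>: "Im \<tau> > 0"
  shows "is_CD \<tau> (\<lambda>z. if z \<in> cd_poles \<tau> then 0 else cd_prod \<tau> z)" (is "is_CD \<tau> ?F")
  unfolding is_CD_def
proof (intro conjI allI impI)
  show "?F nicely_meromorphic_on UNIV"
    by (rule cd_like_nicely_meromorphic[OF \<tau> cd_prod_cd_like[OF \<tau>]]) simp
next
  fix x y :: real and z :: complex
  assume z: "z = of_real x + of_real y * \<tau>" and y: "\<bar>y\<bar> < 1 / 2"
  hence "?F z = cd_sec \<tau> z"
    using cd_like_unique[OF \<tau> cd_prod_cd_like[OF \<tau>] cd_sec_cd_like[OF \<tau>], of z]
      strip_not_cd_poles[OF \<tau> z] by simp
  thus "(\<lambda>n. \<i> / 2 * ((-1) ^ n * cos ((2 * of_nat n + 1) * of_real pi * z)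
            / sin ((of_nat n + 1/2) * of_real pi * \<tau>))) sums ?F z"
    using cd_sec_sums[OF \<tau> z y] by simp
next
  fix x y :: real and z :: complex
  assume z: "z = of_real x + of_real y * \<tau>" and x: "\<bar>x\<bar> < 1 / 2"
  hence "?F z = cd_tan \<tau> z"
    using cd_like_unique[OF \<tau> cd_prod_cd_like[OF \<tau>] cd_tan_cd_like[OF \<tau>], of z]
      strip_not_cd_poles[OF \<tau> z] by simp
  thus "(\<lambda>n. \<i> / (2 * \<tau>) * ((-1) ^ Suc n * cos (2 * of_nat (Suc n) * of_real pi * z / \<tau>)
            / cos (of_nat (Suc n) * of_real pi / \<tau>))) sums (?F z - \<i> / (4 * \<tau>))"
    using cd_tan_sums[OF \<tau> z x] by (simp only:)
qed

text \<open>The conjunct \<open>is_CD\<close> certifies that the definite description behind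
  \<open>CD\<close> denotes; the convergence conjuncts do the same for the infinite
  products.\<close>

theorem mainTheorem11:
  fixes \<tau> :: complex
  assumes "Im \<tau> > 0"
  shows "is_CD \<tau> (\<lambda>z. CD z \<tau>) \<and>
    convergent_prod (\<lambda>n. (1 - qpow \<tau> (real n + 1))\<^sup>2 / (1 - qpow \<tau> (real n + 1/2))\<^sup>2) \<and>
    (\<forall>z. \<not> is_pole (\<lambda>w. CD w \<tau>) z \<longrightarrow>
      convergent_prod (\<lambda>n.
        ((1 + exp (2 * \<i> * of_real pi * z) * qpow \<tau> (real n + 1)) *
         (1 + exp (- 2 * \<i> * of_real pi * z) * qpow \<tau> (real n + 1))) /
        ((1 + exp (2 * \<i> * of_real pi * z) * qpow \<tau> (real n + 1/2)) *
         (1 + exp (- 2 * \<i> * of_real pi * z) * qpow \<tau> (real n + 1/2)))) \<and>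
      CD z \<tau> =
        cos (of_real pi * z) * qpow \<tau> (1/4) *
        (\<Prod>n. (1 - qpow \<tau> (real n + 1))\<^sup>2 / (1 - qpow \<tau> (real n + 1/2))\<^sup>2) *
        (\<Prod>n.
          ((1 + exp (2 * \<i> * of_real pi * z) * qpow \<tau> (real n + 1)) *
           (1 + exp (- 2 * \<i> * of_real pi * z) * qpow \<tau> (real n + 1))) /
          ((1 + exp (2 * \<i> * of_real pi * z) * qpow \<tau> (real n + 1/2)) *
           (1 + exp (- 2 * \<i> * of_real pi * z) * qpow \<tau> (real n + 1/2)))))"
proof -
  define F where "F = (\<lambda>z. if z \<in> cd_poles \<tau> then 0 else cd_prod \<tau> z)"
  have F: "is_CD \<tau> F" unfolding F_def by (rule is_CD_cd_prod[OF assms])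
  hence "(THE F. is_CD \<tau> F) = F"
    using is_CD_unique[OF assms] by (intro the_equality) auto
  hence CD: "(\<lambda>z. CD z \<tau>) = F" by (simp add: CD_def)
  note pre = has_prod_cd_prefactor[OF assms, unfolded has_prod_iff]
  show ?thesis
  proof (intro conjI allI impI)
    show "is_CD \<tau> (\<lambda>z. CD z \<tau>)" unfolding CD by (rule F)
    show "convergent_prod (\<lambda>n. (1 - qpow \<tau> (real n + 1))\<^sup>2 / (1 - qpow \<tau> (real n + 1/2))\<^sup>2)"
      using pre by blast
    fix z assume "\<not> is_pole (\<lambda>w. CD w \<tau>) z"
    \<comment> \<open>Every point of \<open>cd_poles\<close> is a genuine pole because the residue
      there is nonzero.\<close>
    hence z: "z \<notin> cd_poles \<tau>"
      unfolding CD F_def using cd_like_is_pole[OF cd_prod_cd_like[OF assms]] by blast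
    note quot = has_prod_cd_quotient[OF assms, of "exp (2 * \<i> * of_real pi * z)"
        "exp (- 2 * \<i> * of_real pi * z)", unfolded has_prod_iff]
    show "convergent_prod (\<lambda>n.
        ((1 + exp (2 * \<i> * of_real pi * z) * qpow \<tau> (real n + 1)) *
         (1 + exp (- 2 * \<i> * of_real pi * z) * qpow \<tau> (real n + 1))) /
        ((1 + exp (2 * \<i> * of_real pi * z) * qpow \<tau> (real n + 1/2)) *
         (1 + exp (- 2 * \<i> * of_real pi * z) * qpow \<tau> (real n + 1/2))))"
      using quot by blast
    have "CD z \<tau> = cd_prod \<tau> z" using z fun_cong[OF CD, of z] by (simp add: F_def)
    thus "CD z \<tau> =
        cos (of_real pi * z) * qpow \<tau> (1/4) *
        (\<Prod>n. (1 - qpow \<tau> (real n + 1))\<^sup>2 / (1 - qpow \<tau> (real n + 1/2))\<^sup>2) *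
        (\<Prod>n.
          ((1 + exp (2 * \<i> * of_real pi * z) * qpow \<tau> (real n + 1)) *
           (1 + exp (- 2 * \<i> * of_real pi * z) * qpow \<tau> (real n + 1))) /
          ((1 + exp (2 * \<i> * of_real pi * z) * qpow \<tau> (real n + 1/2)) *
           (1 + exp (- 2 * \<i> * of_real pi * z) * qpow \<tau> (real n + 1/2))))"
      unfolding cd_prod_def Let_def conjunct2[OF pre] conjunct2[OF quot] .
  qed
qed

end
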